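(* Let $0<\delta<\pi$. For each integer $n>\max\{2/(\pi-\delta),\,e\}$, there holds $$\mathcal{E}_n(\mathcal{A}_2)\le\sqrt{\frac{121}{200}}\,e^{3/4}\,\sqrt{2+\pi-\delta}\,\left(\frac{\ln n+1}{2n}\right)^{1/4}\exp\left(-\frac{\pi-\delta}{2}n\right).$$
   Context: $J_n:=\{j\in\mathbb{Z}:-n+1\le j\le n\}$ and $\operatorname{sinc}(t):=\frac{\sin\pi t}{\pi t}$ (with $\operatorname{sinc}(0)=1$). $\mathcal{B}_\delta$ is the Paley-Wiener space of functions $f\in C(\mathbb{R})\cap L^2(\mathbb{R})$ with Fourier transform supported on $[-\delta,\delta]$, with the $L^2(\mathbb{R})$ norm; $U(\mathcal{B}_\delta)$ is its closed unit ball. The Fourier transform is $\hat f(\xi)=\frac1{\sqrt{2\pi}}\int_{\mathbb{R}}f(t)e^{-it\xi}dt$. A random process $X=X(t,\omega)$ on a probability space $(\Omega,\mathscr{F},P)$ is w.s.s. (wide sense stationary) if $X(t,\cdot)\in L^2(\Omega,dP)$ for every $t\in\mathbb{R}$ and $R_X(t,\tau):=\int_\Omega X(t,\omega)\overline{X(\tau,\omega)}\,dP(\omega)$ depends only on $t-\tau$; one writes $R_X(t):=R_X(t,0)$. For $k\in\mathbb{N}$, $B_k$ is the spline function supported on $[-\pi+\delta,\pi-\delta]$ determined by its Fourier transform $$\hat{B_k}(\xi)=\frac1{\sqrt{2\pi}\,(i(\pi-\delta)\xi)^k}\sum_{j=0}^k(-1)^{k-j}\alpha_{kj}e^{-ix_{kj}(\pi-\delta)\xi},\qquad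 \xi\in\mathbb{R}$$ (extended continuously to $\xi=0$), where $x_{kj}:=\cos\frac{j\pi}{k}$, $0\le j\le k$, and $\alpha_{kj}$, $0\le j\le k$, are the unique nonnegative constants satisfying $\sum_{j=0}^k(-1)^{k-j}\alpha_{kj}x_{kj}^l=0$ for $0\le l\le k-1$ and $\sum_{j=0}^k\alpha_{kj}=\sqrt{2\pi}\,2^{k-1}k!$. The following facts about $B_k$ are known: $|\hat{B_k}(\xi)|\le\frac{2^{k-1}k!}{(\pi-\delta)^k|\xi|^k}$ for $\xi\neq0$, and $f(t)=\sum_{j\in\mathbb{Z}}f(j)\operatorname{sinc}(t-j)\hat{B_k}(t-j)$ for all $t\in\mathbb{R}$ and $f\in\mathcal{B}_\delta$. The reconstruction algorithm $\mathcal{A}_2$ is $$(\mathcal{A}_2X)(t,\omega):=\sum_{j\in J_n}X(j,\omega)\operatorname{sinc}(t-j)\hat{B_m}(t-j),\qquad m=\lfloor n(\pi-\delta)/2\rfloor,$$ and its approximation error is $$\mathcal{E}_n(\mathcal{A}_2):=\sup\bigl\{\|X(t,\cdot)-(\mathcal{A}_2X)(t,\cdot)\|_{L^2(\Omega,dP(\omega))}:t\in(0,1),\ R_X\in U(\mathcal{B}_\delta)\bigr\},$$ the supremum being over all $t\in(0,1)$ and all w.s.s. random processes $X$ with $R_X\in U(\mathcal{B}_\delta)$. *)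

theory Defs
  imports "HOL-Probability.Probability"
begin

section \<open>Square-integrable functions and the Paley--Wiener space\<close>

definition square_integrable :: "'a measure \<Rightarrow> ('a \<Rightarrow> complex) \<Rightarrow> bool" where
  "square_integrable M f \<longleftrightarrow>
     f \<in> borel_measurable M \<and> integrable M (\<lambda>x. (cmod (f x))\<^sup>2)"

text \<open>Only meaningful for functions satisfying \<open>square_integrable\<close>: the Bochner integral of a
  non-integrable function is 0.\<close>
definition L2_norm :: "'a measure \<Rightarrow> ('a \<Rightarrow> complex) \<Rightarrow> real" where
  "L2_norm M f = sqrt (LINT x|M. (cmod (f x))\<^sup>2)"

definition fourier_trunc :: "real \<Rightarrow> (real \<Rightarrow> complex) \<Rightarrow> real \<Rightarrow> complex" where
  "fourier_trunc T f \<xi> =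
     complex_of_real (1 / sqrt (2 * pi)) *
     (LINT t:{-T..T}|lborel. f t * exp (- \<i> * complex_of_real (t * \<xi>)))"

text \<open>A function in \<open>L\<^sup>2(\<real>)\<close> need not be integrable, so its Fourier transform is understood
  in the sense of Plancherel, as the limit in \<open>L\<^sup>2\<close> of the truncated Fourier integrals. It is
  determined only almost everywhere and is therefore rendered as a relation. The convergence is
  stated with the nonnegative integral, so that no square-integrability of the truncated
  transforms is presupposed.\<close>
definition has_L2_fourier_transform ::
    "(real \<Rightarrow> complex) \<Rightarrow> (real \<Rightarrow> complex) \<Rightarrow> bool" where
  "has_L2_fourier_transform f g \<longleftrightarrow>
     square_integrable lborel f \<and> square_integrable lborel g \<and>
     ((\<lambda>T. \<integral>\<^sup>+\<xi>. ennreal ((cmod (fourier_trunc T f \<xi> - g \<xi>))\<^sup>2) \<partial>lborel) \<longlongrightarrow> 0) at_top"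

definition paley_wiener :: "real \<Rightarrow> (real \<Rightarrow> complex) set" where
  "paley_wiener \<delta> =
     {f. continuous_on UNIV f \<and> square_integrable lborel f \<and>
         (\<exists>g. has_L2_fourier_transform f g \<and> (AE \<xi> in lborel. \<xi> \<notin> {-\<delta>..\<delta>} \<longrightarrow> g \<xi> = 0))}"

definition paley_wiener_unit_ball :: "real \<Rightarrow> (real \<Rightarrow> complex) set" where
  "paley_wiener_unit_ball \<delta> = {f \<in> paley_wiener \<delta>. L2_norm lborel f \<le> 1}"


section \<open>Wide sense stationary processes\<close>

definition autocorr2 :: "'w measure \<Rightarrow> (real \<Rightarrow> 'w \<Rightarrow> complex) \<Rightarrow> real \<Rightarrow> real \<Rightarrow> complex" where
  "autocorr2 M X t \<tau> = (LINT \<omega>|M. X t \<omega> * cnj (X \<tau> \<omega>))"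

definition autocorr :: "'w measure \<Rightarrow> (real \<Rightarrow> 'w \<Rightarrow> complex) \<Rightarrow> real \<Rightarrow> complex" where
  "autocorr M X t = autocorr2 M X t 0"

definition wss :: "'w measure \<Rightarrow> (real \<Rightarrow> 'w \<Rightarrow> complex) \<Rightarrow> bool" where
  "wss M X \<longleftrightarrow>
     (\<forall>t. square_integrable M (X t)) \<and> (\<exists>R. \<forall>t \<tau>. autocorr2 M X t \<tau> = R (t - \<tau>))"


section \<open>The spline windows and the reconstruction algorithm\<close>

text \<open>The normalised cardinal sine, as opposed to the library's \<open>sinc\<close>, which is
  \<open>sin t / t\<close>.\<close>
definition sinc_pi :: "real \<Rightarrow> real" where
  "sinc_pi t = (if t = 0 then 1 else sin (pi * t) / (pi * t))"

definition knot :: "nat \<Rightarrow> nat \<Rightarrow> real" where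
  "knot k j = cos (real j * pi / real k)"

text \<open>The value is fixed to be 0 for \<open>j > k\<close> so that the coefficients are unique as a function
  on \<^typ>\<open>nat\<close>. The knots are distinct for \<open>k \<ge> 1\<close>.\<close>
definition spline_coeff :: "nat \<Rightarrow> nat \<Rightarrow> real" where
  "spline_coeff k = (THE \<alpha>.
     (\<forall>j\<le>k. 0 \<le> \<alpha> j) \<and> (\<forall>j>k. \<alpha> j = 0) \<and>
     (\<forall>l<k. (\<Sum>j\<le>k. (-1) ^ (k - j) * \<alpha> j * knot k j ^ l) = 0) \<and>
     (\<Sum>j\<le>k. \<alpha> j) = sqrt (2 * pi) * 2 ^ (k - 1) * fact k)"

definition spline_ft_formula :: "real \<Rightarrow> nat \<Rightarrow> real \<Rightarrow> complex" where
  "spline_ft_formula \<delta> k \<xi> =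
     1 / (complex_of_real (sqrt (2 * pi)) * (\<i> * complex_of_real ((pi - \<delta>) * \<xi>)) ^ k) *
     (\<Sum>j\<le>k. (-1) ^ (k - j) * complex_of_real (spline_coeff k j) *
        exp (- \<i> * complex_of_real (knot k j * (pi - \<delta>) * \<xi>)))"

text \<open>The Fourier transform of the spline \<open>B\<^sub>k\<close>. The formula has a removable
  singularity at 0.\<close>
definition spline_ft :: "real \<Rightarrow> nat \<Rightarrow> real \<Rightarrow> complex" where
  "spline_ft \<delta> k \<xi> =
     (if \<xi> = 0 then Lim (at 0) (spline_ft_formula \<delta> k) else spline_ft_formula \<delta> k \<xi>)"

definition J :: "nat \<Rightarrow> int set" where
  "J n = {- int n + 1..int n}"

definition A2 :: "real \<Rightarrow> nat \<Rightarrow> (real \<Rightarrow> 'w \<Rightarrow> complex) \<Rightarrow> real \<Rightarrow> 'w \<Rightarrow> complex" where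
  "A2 \<delta> n X t \<omega> =
     (let m = nat \<lfloor>real n * (pi - \<delta>) / 2\<rfloor> in
      \<Sum>j\<in>J n. X (of_int j) \<omega> * complex_of_real (sinc_pi (t - of_int j)) *
        spline_ft \<delta> m (t - of_int j))"

text \<open>The supremum is taken in the extended reals, where it exists without a boundedness
  assumption and bounds every member of the set.\<close>
definition error_A2 :: "'w measure \<Rightarrow> real \<Rightarrow> nat \<Rightarrow> ereal" where
  "error_A2 M \<delta> n =
     Sup {ereal (L2_norm M (\<lambda>\<omega>. X t \<omega> - A2 \<delta> n X t \<omega>)) | t X.
            t \<in> {0<..<1} \<and> wss M X \<and> autocorr M X \<in> paley_wiener_unit_ball \<delta>}"

end

theory Submission
  imports Defs "HOL-Complex_Analysis.Residue_Theorem" "HOL-Real_Asymp.Real_Asymp"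
begin

text \<open>The autocorrelation \<open>R\<close> of the process has an \<open>L\<^sup>2\<close> Fourier transform \<open>g\<close> which
vanishes outside \<open>[-\<delta>, \<delta>]\<close>. Since \<open>g\<close> is then integrable, Fourier inversion expresses every
covariance as \<open>\<surd>(2\<pi>) R u = \<integral> g \<xi> exp (\<i> u \<xi>) d\<xi>\<close>. Consequently the mean square of a finite
combination \<open>\<Sum> b\<^sub>j X (s\<^sub>j)\<close>, multiplied by \<open>\<surd>(2\<pi>)\<close>, equals
\<open>\<integral> g \<xi> \<bar>\<Sum> b\<^sub>j exp (\<i> s\<^sub>j \<xi>)\<bar>\<^sup>2 d\<xi>\<close> (\<open>wss_spectral_isometry\<close>): reconstructing the process is the same problem as reconstructing the
exponential \<open>t \<mapsto> exp (\<i> \<xi> t)\<close> for the frequencies \<open>\<xi>\<close> in the band.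

For exponentials the spline-windowed cardinal series is exact (\<open>spline_sampling_exponential\<close>).
This is the residue theorem for \<open>exp (\<i> \<xi> z) P (t - z) / ((t - z)\<^sup>k\<^sup>+\<^sup>1 sin \<pi>z)\<close> on large circles, where
\<open>P (z) / z\<^sup>k\<close> is the transform of the spline: its exponential type \<open>\<pi> - \<delta>\<close> together with
\<open>\<bar>\<xi>\<bar> \<le> \<delta>\<close> just matches the growth of \<open>sin \<pi>z\<close>. The residue at \<open>z = t\<close> needs the value 1 of the
transform at the origin, which comes from the closed form of the spline coefficients: by discrete
orthogonality of the cosines at the Chebyshev extreme points they are those of the trapezoidal rule.

The error is therefore governed by the tail \<open>r \<xi> = \<Sum> c\<^sub>j exp (\<i> j \<xi>)\<close> over the integers \<open>j\<close> that are
left out. Estimating one factor of \<open>\<bar>r\<bar>\<^sup>2\<close> by the \<open>\<ell>\<^sup>1\<close> norm of the tail coefficients and the other one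
by Cauchy--Schwarz, Parseval and Plancherel (\<open>\<parallel>g\<parallel> = \<parallel>R\<parallel> \<le> 1\<close>) bounds the mean square error by the
product of the \<open>\<ell>\<^sup>1\<close> and \<open>\<ell>\<^sup>2\<close> norms of the tail (\<open>weighted_tail_bound\<close>). The bound on the spline
transform makes \<open>c\<^sub>j\<close> decay like \<open>2\<^sup>m\<^sup>-\<^sup>1 m! / (\<pi> (\<pi> - \<delta>)\<^sup>m \<bar>t - j\<bar>\<^sup>m\<^sup>+\<^sup>1)\<close>, and with
\<open>m \<approx> n (\<pi> - \<delta>) / 2\<close> Stirling's inequality turns the two norms into the factor
\<open>exp (- (\<pi> - \<delta>) n)\<close> (\<open>error_constant_le\<close>).\<close>

section \<open>Coefficients of the perfect B-spline\<close>

text \<open>The weights of the trapezoidal rule on \<open>k + 1\<close> nodes; they arise because each interior node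
\<open>cos (j \<pi> / k)\<close> is hit by two of the \<open>2 k\<close>-th roots of unity and each end point by one.\<close>
definition trapezoid_weight :: "nat \<Rightarrow> nat \<Rightarrow> real" where
  "trapezoid_weight k j = (if j = 0 \<or> j = k then 1 / 2 else 1)"

lemma trapezoid_sum:
  assumes "k \<ge> 1"
  shows "(\<Sum>j\<le>k. trapezoid_weight k j * a j) = ((\<Sum>j<k. a j) + (\<Sum>j<k. a (Suc j))) / 2"
proof -
  obtain r where k: "k = Suc r" using assms by (cases k) auto
  have "(\<Sum>j\<le>k. trapezoid_weight k j * a j) = (\<Sum>j\<in>insert 0 (insert k {1..r}). trapezoid_weight k j * a j)"
    by (rule sum.cong) (auto simp: k)
  also have "\<dots> = a 0 / 2 + a k / 2 + (\<Sum>j\<in>{1..r}. trapezoid_weight k j * a j)"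
    by (simp add: k trapezoid_weight_def)
  also have "(\<Sum>j\<in>{1..r}. trapezoid_weight k j * a j) = (\<Sum>j\<in>{1..r}. a j)"
    by (rule sum.cong) (auto simp: trapezoid_weight_def k)
  also have "(\<Sum>j\<in>{1..r}. a j) = (\<Sum>j<r. a (Suc j))"
    by (rule sum.reindex_bij_witness[of _ Suc "\<lambda>j. j - 1"]) auto
  finally have "(\<Sum>j\<le>k. trapezoid_weight k j * a j) = a 0 / 2 + a k / 2 + (\<Sum>j<r. a (Suc j))" .
  moreover have "(\<Sum>j<k. a j) = a 0 + (\<Sum>j<r. a (Suc j))"
    unfolding k by (rule sum.lessThan_Suc_shift)
  moreover have "(\<Sum>j<k. a (Suc j)) = (\<Sum>j<r. a (Suc j)) + a k"
    unfolding k by simp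
  ultimately show ?thesis by simp
qed

lemma sum_roots_of_unity:
  fixes k q :: nat
  assumes "k \<ge> 1"
  shows "(\<Sum>j<2*k. cis (real j * pi / k) ^ q) = (if 2 * k dvd q then 2 * of_nat k else 0)"
proof -
  define x where "x = cis (pi * q / k)"
  have pw: "cis (real j * pi / k) ^ q = x ^ j" for j
  proof -
    have "cis (real j * pi / k) ^ q = cis (real q * (real j * pi / k))" by (rule Complex.DeMoivre)
    also have "real q * (real j * pi / k) = real j * (pi * q / k)" by simp
    also have "cis \<dots> = x ^ j" unfolding x_def by (rule Complex.DeMoivre[symmetric])
    finally show ?thesis .
  qed
  have x1: "x ^ (2 * k) = 1"
  proof -
    have "x ^ (2 * k) = cis (2 * pi * real q)"
      unfolding x_def Complex.DeMoivre using assms by (simp add: field_simps)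
    then show ?thesis by (simp add: cis_multiple_2pi)
  qed
  show ?thesis
  proof (cases "2 * k dvd q")
    case True
    then obtain c where "q = 2 * k * c" by (elim dvdE)
    then have "pi * q / k = 2 * pi * real c" using assms by simp
    then have "x = cis (2 * pi * real c)" by (simp only: x_def)
    then have "x = 1" using cis_multiple_2pi[of "real c"] by (simp only: Ints_of_nat)
    with True show ?thesis by (simp add: pw)
  next
    case False
    have "x \<noteq> 1"
    proof
      assume "x = 1"
      then have "exp (\<i> * of_real (pi * q / k)) = 1" by (simp add: x_def cis_conv_exp)
      then obtain n :: int where "pi * q / k = of_int (2 * n) * pi"
        by (auto simp: exp_eq_1)
      then have "real q = of_int (2 * n) * real k" using assms by (simp add: field_simps)
      then have "int q = 2 * n * int k" by (metis of_int_eq_iff of_int_mult of_int_of_nat_eq)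
      then have "int (2 * k) dvd int q" by simp
      with False show False by (simp add: int_dvd_int_iff del: of_nat_mult)
    qed
    with False show ?thesis
      by (simp add: pw sum_gp_strict x1)
  qed
qed

text \<open>On the full circle of \<open>2 k\<close>-th roots of unity \<open>\<omega>\<close>, the sign \<open>(-1)\<^sup>j\<close> is \<open>\<omega>\<^sup>k\<close> and the
knot is the mean of \<open>\<omega>\<close> and its conjugate. After the binomial expansion only exponents
\<open>k + 2 r - l\<close> divisible by \<open>2 k\<close> contribute; for \<open>l < k\<close> there are none, and for \<open>l = k\<close> these
are the two extreme terms \<open>r = 0\<close> and \<open>r = k\<close>.\<close>
lemma sum_alternating_knot_power:
  assumes "k \<ge> 1" "l \<le> k"
  shows "(\<Sum>j<2*k. (-1) ^ j * knot k j ^ l) = (if l = k then 4 * real k / 2 ^ k else 0)"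
proof -
  define \<omega> where "\<omega> = (\<lambda>j. cis (real j * pi / k))"
  \<comment> \<open>The conjugate powers cancel against the sign \<open>\<omega>\<^sup>k\<close>, which leaves natural exponents.\<close>
  have inv: "\<omega> j * cnj (\<omega> j) = 1" for j
    by (simp add: \<omega>_def cis_cnj flip: cis_inverse)
  have knot: "complex_of_real (knot k j) = (\<omega> j + cnj (\<omega> j)) / 2" for j
    by (simp add: knot_def \<omega>_def complex_eq_iff)
  have sgn: "(-1) ^ j = \<omega> j ^ k" for j
  proof -
    have "\<omega> j ^ k = cis (real j * pi)"
      using assms Complex.DeMoivre[of "real j * pi / k" k] by (simp add: \<omega>_def)
    also have "\<dots> = cis pi ^ j" by (simp only: Complex.DeMoivre)
    finally show ?thesis by simp
  qed
  have cancel: "\<omega> j ^ k * (\<omega> j ^ r * cnj (\<omega> j) ^ (l - r)) = \<omega> j ^ (k + 2 * r - l)" if "r \<le> l" for j r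
  proof -
    have "k + r = (k + 2 * r - l) + (l - r)" using that assms by simp
    then have "\<omega> j ^ k * \<omega> j ^ r = \<omega> j ^ (k + 2 * r - l) * \<omega> j ^ (l - r)"
      by (metis power_add)
    then have "\<omega> j ^ k * (\<omega> j ^ r * cnj (\<omega> j) ^ (l - r)) = \<omega> j ^ (k + 2 * r - l) * (\<omega> j * cnj (\<omega> j)) ^ (l - r)"
      by (simp add: power_mult_distrib mult.assoc[symmetric])
    then show ?thesis by (simp add: inv)
  qed
  have "complex_of_real (\<Sum>j<2*k. (-1) ^ j * knot k j ^ l)
      = (\<Sum>j<2*k. \<omega> j ^ k * ((\<omega> j + cnj (\<omega> j)) ^ l / 2 ^ l))"
    by (simp add: knot sgn power_divide)
  also have "\<dots> = (\<Sum>j<2*k. \<Sum>r\<le>l. of_nat (l choose r) / 2 ^ l * \<omega> j ^ (k + 2 * r - l))"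
  proof (rule sum.cong[OF refl])
    fix j
    have "\<omega> j ^ k * ((\<omega> j + cnj (\<omega> j)) ^ l / 2 ^ l)
       = (\<Sum>r\<le>l. of_nat (l choose r) / 2 ^ l * (\<omega> j ^ k * (\<omega> j ^ r * cnj (\<omega> j) ^ (l - r))))"
      by (simp add: binomial_ring sum_distrib_left sum_divide_distrib mult_ac)
    also have "\<dots> = (\<Sum>r\<le>l. of_nat (l choose r) / 2 ^ l * \<omega> j ^ (k + 2 * r - l))"
      by (intro sum.cong refl) (simp add: cancel)
    finally show "\<omega> j ^ k * ((\<omega> j + cnj (\<omega> j)) ^ l / 2 ^ l)
       = (\<Sum>r\<le>l. of_nat (l choose r) / 2 ^ l * \<omega> j ^ (k + 2 * r - l))" .
  qed
  also have "\<dots> = (\<Sum>r\<le>l. of_nat (l choose r) / 2 ^ l * (\<Sum>j<2*k. \<omega> j ^ (k + 2 * r - l)))"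
    by (subst sum.swap) (simp add: sum_distrib_left)
  also have "\<dots> = (\<Sum>r\<le>l. if 2 * k dvd k + 2 * r - l then of_nat (l choose r) / 2 ^ l * (2 * of_nat k) else 0)"
    by (intro sum.cong refl) (simp add: \<omega>_def sum_roots_of_unity[OF assms(1)])
  also have "\<dots> = of_real (if l = k then 4 * real k / 2 ^ k else 0)"
  proof (cases "l = k")
    case True
    have "(\<Sum>r\<le>l. if 2 * k dvd k + 2 * r - l then of_nat (l choose r) / 2 ^ l * (2 * of_nat k) else 0)
        = (\<Sum>r\<in>{0, k}. of_nat (l choose r) / 2 ^ l * (2 * complex_of_nat k))"
    proof (rule sum.mono_neutral_cong_right)
      show "\<forall>i\<in>{..l} - {0, k}. (if 2 * k dvd k + 2 * i - l then of_nat (l choose i) / 2 ^ l * (2 * of_nat k) else 0) = (0::complex)"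
        using True by (auto dest!: dvd_imp_le)
    qed (use True in auto)
    also have "\<dots> = of_real (4 * real k / 2 ^ k)"
      using assms True by (simp add: field_simps)
    finally show ?thesis using True by simp
  next
    case False
    have "\<not> 2 * k dvd k + 2 * r - l" if "r \<le> l" for r
    proof
      assume "2 * k dvd k + 2 * r - l"
      then have "2 * k \<le> k + 2 * r - l" using False assms that by (intro dvd_imp_le) auto
      then show False using that False assms by linarith
    qed
    then show ?thesis using False by (auto intro!: sum.neutral)
  qed
  finally show ?thesis by (simp only: of_real_eq_iff)
qed

text \<open>Folding the full circle along the real axis, \<open>j \<mapsto> 2 k - j\<close>, turns the sum over all roots of
unity into twice the trapezoidal sum over the knots.\<close>
lemma trapezoid_alternating_knot_power:
  assumes "k \<ge> 1" "l \<le> k"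
  shows "(\<Sum>j\<le>k. trapezoid_weight k j * ((-1) ^ j * knot k j ^ l))
       = (if l = k then 2 * real k / 2 ^ k else 0)"
proof -
  define a where "a = (\<lambda>j. (-1) ^ j * knot k j ^ l)"
  have refl: "a (2 * k - j) = a j" if "j \<le> k" for j
  proof -
    have "real (2 * k - j) * pi / k = 2 * pi - real j * pi / k"
      using that assms by (simp add: of_nat_diff field_simps)
    then have "knot k (2 * k - j) = knot k j"
      by (simp add: knot_def cos_diff)
    moreover have "(-1::real) ^ (2 * k - j) = (-1) ^ j"
      using that by (simp add: minus_one_power_iff)
    ultimately show ?thesis by (simp add: a_def)
  qed
  have "(\<Sum>j<2*k. a j) = (\<Sum>j<k. a j) + (\<Sum>j\<in>{k..<2*k}. a j)"
    by (subst sum.union_disjoint[symmetric]) (auto intro!: sum.cong)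
  also have "(\<Sum>j\<in>{k..<2*k}. a j) = (\<Sum>j<k. a (Suc j))"
    by (rule sum.reindex_bij_witness[of _ "\<lambda>j. 2 * k - Suc j" "\<lambda>j. 2 * k - Suc j"])
       (auto simp: Suc_diff_Suc simp flip: refl)
  finally have "(\<Sum>j\<le>k. trapezoid_weight k j * a j) = (\<Sum>j<2*k. a j) / 2"
    using trapezoid_sum[OF assms(1), of a] by simp
  then show ?thesis
    using sum_alternating_knot_power[OF assms] by (auto simp: a_def)
qed

lemma knot_inj:
  assumes "i \<le> k" "j \<le> k" "knot k i = knot k j" "k \<ge> 1"
  shows "i = j"
proof -
  have r0: "0 \<le> real i * pi / k" for i by simp
  have r1: "real i * pi / k \<le> pi" if "i \<le> k" for i
  proof -
    have "real i * pi \<le> real k * pi" using that by (intro mult_right_mono) auto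
    then show ?thesis using assms(4) by (simp add: pos_divide_le_eq mult.commute)
  qed
  have "real i * pi / k = real j * pi / k"
    using r0 r1[OF assms(1)] r0 r1[OF assms(2)] assms(3)[unfolded knot_def] by (rule cos_inj_pi)
  then show ?thesis using assms(4) by (simp add: field_simps)
qed

text \<open>The \<open>k\<close> moment conditions say that the weights annihilate all polynomials of degree less than
\<open>k\<close>. Testing with the polynomial that vanishes at all knots except \<open>0\<close> and \<open>j\<close> leaves only the
terms of these two indices, and the first one is zero. Hence the solutions of the moment conditions form a line, which is what makes
the spline coefficients unique.\<close>
lemma moments_determine_weights:
  fixes v :: "nat \<Rightarrow> real"
  assumes "k \<ge> 1" and mom: "\<And>l. l < k \<Longrightarrow> (\<Sum>j\<le>k. v j * knot k j ^ l) = 0"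
    and "v 0 = 0" "j \<le> k"
  shows "v j = 0"
proof (cases "j = 0")
  case False
  define p where "p = (\<Prod>i\<in>{1..k}-{j}. [:- knot k i, 1:])"
  have "degree p \<le> sum (degree \<circ> (\<lambda>i. [:- knot k i, 1:])) ({1..k}-{j})"
    unfolding p_def by (rule degree_prod_sum_le) auto
  also have "\<dots> = k - 1" using assms False by simp
  finally have deg: "degree p < k" using assms by simp
  have ev: "poly p x = (\<Prod>i\<in>{1..k}-{j}. x - knot k i)" for x
    by (simp add: p_def poly_prod)
  have "(\<Sum>i\<le>k. v i * poly p (knot k i)) = (\<Sum>l\<le>degree p. coeff p l * (\<Sum>i\<le>k. v i * knot k i ^ l))"
    unfolding poly_altdef sum_distrib_left by (subst sum.swap) (simp add: mult_ac)
  also have "\<dots> = 0"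
    using mom deg by (intro sum.neutral) auto
  finally have "(\<Sum>i\<le>k. v i * poly p (knot k i)) = 0" .
  moreover have "(\<Sum>i\<le>k. v i * poly p (knot k i)) = (\<Sum>i\<in>{j}. v i * poly p (knot k i))"
  proof (rule sum.mono_neutral_right)
    show "\<forall>i\<in>{..k} - {j}. v i * poly p (knot k i) = 0"
    proof
      fix i assume i: "i \<in> {..k} - {j}"
      show "v i * poly p (knot k i) = 0"
        using i \<open>v 0 = 0\<close> by (cases "i = 0") (auto simp: ev intro!: prod_zero)
    qed
  qed (use assms(4) in auto)
  moreover have "poly p (knot k j) \<noteq> 0"
  proof -
    have "knot k j - knot k i \<noteq> 0" if "i \<in> {1..k}-{j}" for i
    proof
      assume "knot k j - knot k i = 0"
      then have "j = i" using that assms by (intro knot_inj[of j k i]) auto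
      then show False using that by simp
    qed
    then show ?thesis unfolding ev by simp
  qed
  ultimately show ?thesis by simp
qed (use assms(3) in simp)

text \<open>The prescribed sum of the spline coefficients.\<close>
definition spline_mass :: "nat \<Rightarrow> real" where
  "spline_mass k = sqrt (2 * pi) * 2 ^ (k - 1) * fact k"

lemma spline_mass_pos: "spline_mass k > 0"
  by (simp add: spline_mass_def)

text \<open>The trapezoidal weights, normalised to the prescribed sum: the closed form of the
spline coefficients.\<close>
definition perfect_coeff :: "nat \<Rightarrow> nat \<Rightarrow> real" where
  "perfect_coeff k j = (if j \<le> k then spline_mass k / k * trapezoid_weight k j else 0)"

lemma perfect_coeff_nonneg: "0 \<le> perfect_coeff k j"
  using spline_mass_pos[of k] by (simp add: perfect_coeff_def trapezoid_weight_def)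

lemma sum_perfect_coeff:
  assumes "k \<ge> 1"
  shows "(\<Sum>j\<le>k. perfect_coeff k j) = spline_mass k"
proof -
  have "(\<Sum>j\<le>k. perfect_coeff k j) = spline_mass k / k * (\<Sum>j\<le>k. trapezoid_weight k j * 1)"
    by (simp add: perfect_coeff_def sum_distrib_left)
  also have "(\<Sum>j\<le>k. trapezoid_weight k j * 1) = real k"
    using trapezoid_sum[OF assms, of "\<lambda>_. 1"] by simp
  finally show ?thesis using assms by simp
qed

text \<open>The moment of order \<open>k\<close> fixes the value of the spline transform at the origin.\<close>
lemma perfect_coeff_moment:
  assumes "k \<ge> 1" "l \<le> k"
  shows "(\<Sum>j\<le>k. (-1) ^ (k - j) * perfect_coeff k j * knot k j ^ l)
       = (if l = k then (-1) ^ k * sqrt (2 * pi) * fact k else 0)"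
proof -
  have "(\<Sum>j\<le>k. (-1) ^ (k - j) * perfect_coeff k j * knot k j ^ l)
     = (\<Sum>j\<le>k. (-1) ^ k * (spline_mass k / k) * (trapezoid_weight k j * ((-1) ^ j * knot k j ^ l)))"
  proof (intro sum.cong refl)
    fix j assume "j \<in> {..k}"
    then have j: "j \<le> k" by simp
    then have "(-1::real) ^ (k - j) = (-1) ^ k * (-1) ^ j"
      by (simp add: minus_one_power_iff)
    then show "(-1) ^ (k - j) * perfect_coeff k j * knot k j ^ l
        = (-1) ^ k * (spline_mass k / k) * (trapezoid_weight k j * ((-1) ^ j * knot k j ^ l))"
      using j by (simp add: perfect_coeff_def)
  qed
  also have "\<dots> = (-1) ^ k * (spline_mass k / k) * (\<Sum>j\<le>k. trapezoid_weight k j * ((-1) ^ j * knot k j ^ l))"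
    by (simp add: sum_distrib_left)
  also have "\<dots> = (if l = k then (-1) ^ k * sqrt (2 * pi) * fact k else 0)"
  proof -
    have "2 ^ k = (2::real) * 2 ^ (k - 1)" using assms by (cases k) auto
    then show ?thesis
      using assms by (simp add: trapezoid_alternating_knot_power[OF assms] spline_mass_def)
  qed
  finally show ?thesis .
qed

lemma spline_coeff_eq:
  assumes "k \<ge> 1"
  shows "spline_coeff k = perfect_coeff k"
  unfolding spline_coeff_def
proof (rule the_equality)
  show "(\<forall>j\<le>k. 0 \<le> perfect_coeff k j) \<and> (\<forall>j>k. perfect_coeff k j = 0) \<and>
     (\<forall>l<k. (\<Sum>j\<le>k. (-1) ^ (k - j) * perfect_coeff k j * knot k j ^ l) = 0) \<and>
     (\<Sum>j\<le>k. perfect_coeff k j) = sqrt (2 * pi) * 2 ^ (k - 1) * fact k"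
  proof (intro conjI allI impI)
    show "(\<Sum>j\<le>k. (-1) ^ (k - j) * perfect_coeff k j * knot k j ^ l) = 0" if "l < k" for l
      using perfect_coeff_moment[OF assms, of l] that by simp
    show "(\<Sum>j\<le>k. perfect_coeff k j) = sqrt (2 * pi) * 2 ^ (k - 1) * fact k"
      using sum_perfect_coeff[OF assms] by (simp add: spline_mass_def)
  qed (simp add: perfect_coeff_nonneg, simp add: perfect_coeff_def)
next
  fix b :: "nat \<Rightarrow> real"
  assume b: "(\<forall>j\<le>k. 0 \<le> b j) \<and> (\<forall>j>k. b j = 0) \<and>
     (\<forall>l<k. (\<Sum>j\<le>k. (-1) ^ (k - j) * b j * knot k j ^ l) = 0) \<and>
     (\<Sum>j\<le>k. b j) = sqrt (2 * pi) * 2 ^ (k - 1) * fact k"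
  have a0: "perfect_coeff k 0 > 0"
    using assms spline_mass_pos[of k] by (simp add: perfect_coeff_def trapezoid_weight_def)
  define c where "c = b 0 / perfect_coeff k 0"
  have eq: "b j = c * perfect_coeff k j" if "j \<le> k" for j
  proof -
    have "(-1) ^ (k - j) * (b j - c * perfect_coeff k j) = 0"
    proof (rule moments_determine_weights[OF assms])
      fix l assume l: "l < k"
      have "(\<Sum>j\<le>k. (-1) ^ (k - j) * (b j - c * perfect_coeff k j) * knot k j ^ l)
        = (\<Sum>j\<le>k. (-1) ^ (k - j) * b j * knot k j ^ l) - c * (\<Sum>j\<le>k. (-1) ^ (k - j) * perfect_coeff k j * knot k j ^ l)"
        unfolding sum_distrib_left sum_subtractf[symmetric]
        by (intro sum.cong refl) (simp add: algebra_simps)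
      moreover have "(\<Sum>j\<le>k. (-1) ^ (k - j) * b j * knot k j ^ l) = 0" using b l by blast
      ultimately show "(\<Sum>j\<le>k. (-1) ^ (k - j) * (b j - c * perfect_coeff k j) * knot k j ^ l) = 0"
        using perfect_coeff_moment[OF assms, of l] l by simp
    next
      show "(-1) ^ (k - 0) * (b 0 - c * perfect_coeff k 0) = 0" using a0 by (simp add: c_def)
    qed (use that in auto)
    then show ?thesis by simp
  qed
  have "spline_mass k = (\<Sum>j\<le>k. b j)" using b by (simp add: spline_mass_def)
  also have "\<dots> = (\<Sum>j\<le>k. c * perfect_coeff k j)"
    by (intro sum.cong refl) (use eq in blast)
  also have "\<dots> = c * spline_mass k"
    by (simp add: sum_perfect_coeff[OF assms] flip: sum_distrib_left)
  finally have "c = 1" using spline_mass_pos[of k] by simp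
  then have "b j = perfect_coeff k j" for j
    using eq[of j] b by (cases "j \<le> k") (auto simp: perfect_coeff_def)
  then show "b = perfect_coeff k" by (rule ext)
qed

section \<open>Cardinal series by residue calculus\<close>

text \<open>The circles of radius \<open>N + 1/2\<close> stay away from the zeros of \<open>sin \<pi>z\<close>. Away from the real axis
the growth of \<open>sinh\<close> suffices; close to it, \<open>\<bar>Re z\<bar>\<close> is within \<open>1/4\<close> of the half-integer \<open>N + 1/2\<close>,
so that \<open>cos (2 \<pi> Re z) \<le> 0\<close> in the formula for \<open>\<bar>sin \<pi>z\<bar>\<^sup>2\<close>.\<close>
lemma norm_sin_circle_ge:
  fixes z :: complex and N :: nat
  assumes "cmod z = real N + 1 / 2" "N \<ge> 1"
  shows "exp (pi * \<bar>Im z\<bar>) \<le> 4 * cmod (sin (of_real pi * z))"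
proof -
  define x y where "x = \<bar>Re z\<bar>" and "y = \<bar>Im z\<bar>"
  have xy: "x\<^sup>2 + y\<^sup>2 = (real N + 1 / 2)\<^sup>2"
    by (simp add: x_def y_def cmod_power2[symmetric] assms(1))
  have cosx: "cos (2 * (pi * Re z)) = cos (2 * pi * x)"
    by (cases "Re z \<ge> 0") (simp_all add: x_def mult.assoc)
  have four: "4 * (cmod (sin (of_real pi * z)))\<^sup>2
      = exp (2 * pi * Im z) + exp (- (2 * pi * Im z)) - 2 * cos (2 * pi * x)"
    by (simp add: norm_sin_squared cosx exp_minus mult.assoc)
  have expo: "exp (2 * pi * y) \<le> exp (2 * pi * Im z) + exp (- (2 * pi * Im z))"
  proof (cases "Im z \<ge> 0")
    case False
    then have "y = - Im z" by (simp add: y_def)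
    then show ?thesis by simp
  qed (simp add: y_def)
  have "exp (2 * pi * y) / 4 \<le> exp (2 * pi * y) - 2 * cos (2 * pi * x)"
  proof (cases "y \<ge> 1 / 2")
    case True
    \<comment> \<open>The subtracted cosine term is at most \<open>2\<close>, hence at most half of \<open>e\<^sup>2\<^sup>\<pi>\<^sup>y\<close>.\<close>
    have "4 \<le> 1 + 2 * pi * y"
    proof -
      have "2 * pi * (1 / 2) \<le> 2 * pi * y" using True by (intro mult_left_mono) auto
      then show ?thesis using pi_gt3 by linarith
    qed
    also have "\<dots> \<le> exp (2 * pi * y)" by (rule exp_ge_add_one_self)
    finally have "4 \<le> exp (2 * pi * y)" .
    moreover have "cos (2 * pi * x) \<le> 1" by simp
    ultimately show ?thesis by linarith
  next
    case False
    define \<theta> where "\<theta> = real N + 1 / 2 - x"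
    have "0 \<le> y" by (simp add: y_def)
    then have y2: "0 \<le> y\<^sup>2" "y\<^sup>2 \<le> (1 / 2)\<^sup>2"
      using False power_mono[of y "1 / 2" 2] by simp_all
    have "x\<^sup>2 \<le> (real N + 1 / 2)\<^sup>2" using xy y2(1) by linarith
    then have "x \<le> real N + 1 / 2" by (rule power2_le_imp_le) simp
    moreover have "real N + 1 / 4 \<le> x"
    proof (rule power2_le_imp_le)
      have "(real N + 1 / 4)\<^sup>2 = (real N + 1 / 2)\<^sup>2 - (real N / 2 + 3 / 16)"
        by (simp add: power2_eq_square field_simps)
      moreover have "(1 / 2)\<^sup>2 \<le> real N / 2 + 3 / 16"
        using assms(2) by (simp add: power2_eq_square)
      ultimately show "(real N + 1 / 4)\<^sup>2 \<le> x\<^sup>2" using xy y2 by linarith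
    qed (simp add: x_def)
    ultimately have th: "0 \<le> \<theta>" "\<theta> \<le> 1 / 4" by (auto simp: \<theta>_def)
    have "2 * pi * x = (pi - 2 * pi * \<theta>) + 2 * real N * pi"
      by (simp add: \<theta>_def field_simps)
    then have "cos (2 * pi * x) = cos ((pi - 2 * pi * \<theta>) + 2 * real N * pi)" by (simp only:)
    also have "\<dots> = - cos (2 * pi * \<theta>)"
      by (simp only: cos_add cos_diff cos_2npi sin_2npi cos_pi sin_pi) simp
    also have "\<dots> \<le> 0"
    proof -
      have "2 * pi * \<theta> \<le> 2 * pi * (1 / 4)" using th by (intro mult_left_mono) auto
      then have "0 \<le> cos (2 * pi * \<theta>)" using th by (intro cos_ge_zero) (auto intro: order_trans[of _ 0])
      then show ?thesis by simp
    qed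
    finally have "cos (2 * pi * x) \<le> 0" .
    moreover have "0 \<le> exp (2 * pi * y)" by simp
    ultimately show ?thesis by linarith
  qed
  then have "exp (2 * pi * y) \<le> 16 * (cmod (sin (of_real pi * z)))\<^sup>2"
    using four expo by linarith
  then have "(exp (pi * y))\<^sup>2 \<le> (4 * cmod (sin (of_real pi * z)))\<^sup>2"
    by (simp add: power_mult_distrib mult.assoc flip: exp_double)
  then show ?thesis
    unfolding y_def by (rule power2_le_imp_le) simp
qed

text \<open>A cardinal series with window \<open>P (s) / s\<^sup>k\<close>, evaluated by the residue theorem for
\<open>F z = exp (\<i> \<xi> z) P (t - z) / ((t - z)\<^sup>k\<^sup>+\<^sup>1 sin \<pi>z)\<close>: the residues at the integers are the terms of the
series and the residue at \<open>t\<close> is minus its value, all divided by \<open>sin \<pi>t\<close>. The growth condition on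
\<open>P\<close> and the sine bound on the circles leave an integrand of size \<open>N\<^sup>-\<^sup>2\<close>, against a circumference of
order \<open>N\<close>.\<close>
lemma sampling_series_limit:
  fixes P :: "complex \<Rightarrow> complex" and L :: complex and S D t \<xi> :: real and k :: nat
  assumes P: "P holomorphic_on UNIV"
    and growth: "\<And>z. cmod (P z) \<le> S * exp (D * \<bar>Im z\<bar>)"
    and lim0: "((\<lambda>s. P s / s ^ k) \<longlongrightarrow> L) (at 0)"
    and k: "k \<ge> 1" and t: "0 < t" "t < 1" and \<xi>: "\<bar>\<xi>\<bar> + D \<le> pi"
  shows "(\<lambda>N. \<Sum>j\<in>{- int N..int N}. of_real (sinc_pi (t - of_int j)) *
            (P (of_real (t - of_int j)) / of_real (t - of_int j) ^ k) * exp (\<i> * of_real \<xi> * of_int j))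
         \<longlonglongrightarrow> L * exp (\<i> * of_real (\<xi> * t))"
proof -
  define F where "F z = exp (\<i> * of_real \<xi> * z) * P (of_real t - z)
      / ((of_real t - z) ^ Suc k * sin (of_real pi * z))" for z
  define T where "T j = of_real (sinc_pi (t - of_int j)) *
            (P (of_real (t - of_int j)) / of_real (t - of_int j) ^ k) * exp (\<i> * of_real \<xi> * of_int j)" for j :: int
  have sin_t: "sin (pi * t) > 0" using t by (intro sin_gt_zero) auto
  have sin_t': "sin (of_real pi * of_real t :: complex) = of_real (sin (pi * t))"
    by (simp add: sin_of_real[symmetric])
  have t_int: "of_real t \<noteq> (of_int j :: complex)" for j
  proof
    assume "of_real t = (of_int j :: complex)"
    then have "t = of_int j" by (metis of_real_eq_iff of_real_of_int_eq)
    then show False using t by simp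
  qed
  have sin_zero: "sin (of_real pi * z) = 0 \<longleftrightarrow> z \<in> \<int>" for z :: complex
  proof -
    have "sin (of_real pi * z) = 0 \<longleftrightarrow> (\<exists>n::int. of_real pi * z = of_real (of_int n * pi))"
      by (subst mult.commute) (auto simp: sin_eq_0)
    also have "\<dots> \<longleftrightarrow> (\<exists>n::int. z = of_int n)"
      by (simp add: mult.commute)
    finally show ?thesis by (auto simp: Ints_def)
  qed
  have S: "0 \<le> S" using order_trans[OF norm_ge_zero growth[of 0]] by simp
  have F_holo: "F holomorphic_on A - (\<int> \<union> {of_real t})" for A
    unfolding F_def using P
    by (intro holomorphic_intros holomorphic_on_compose_gen[OF _ P, unfolded o_def]) (auto simp: sin_zero)
  have res_t: "residue F (of_real t) = - exp (\<i> * of_real (\<xi> * t)) * L / of_real (sin (pi * t))"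
  proof (rule residue_simple')
    show "open (- (\<int> :: complex set))" by (simp add: closed_Ints open_Compl)
    show "complex_of_real t \<in> - \<int>" using t_int by (auto simp: Ints_def)
    show "F holomorphic_on - \<int> - {of_real t}"
      by (rule holomorphic_on_subset[OF F_holo[of UNIV]]) auto
    have "filterlim (\<lambda>z. of_real t - z) (at 0) (at (complex_of_real t))"
      unfolding filterlim_at by (auto intro!: tendsto_eq_intros simp: eventually_at_filter)
    from filterlim_compose[OF lim0 this]
    have "((\<lambda>z. - exp (\<i> * of_real \<xi> * z) * (P (of_real t - z) / (of_real t - z) ^ k) / sin (of_real pi * z))
        \<longlongrightarrow> - exp (\<i> * of_real \<xi> * of_real t) * L / sin (of_real pi * of_real t)) (at (of_real t))"
      using sin_t by (intro tendsto_intros) (auto simp: sin_t')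
    moreover have "\<forall>\<^sub>F z in at (complex_of_real t).
        - exp (\<i> * of_real \<xi> * z) * (P (of_real t - z) / (of_real t - z) ^ k) / sin (of_real pi * z) = F z * (z - of_real t)"
      unfolding eventually_at_filter
    proof (intro always_eventually allI impI)
      fix z :: complex assume "z \<noteq> of_real t"
      then have nz: "of_real t - z \<noteq> 0" by simp
      have "F z * (z - of_real t) = - (exp (\<i> * of_real \<xi> * z) * P (of_real t - z) * (of_real t - z)
          / ((of_real t - z) * ((of_real t - z) ^ k * sin (of_real pi * z))))"
        by (simp add: F_def algebra_simps diff_divide_distrib)
      also have "\<dots> = - (exp (\<i> * of_real \<xi> * z) * P (of_real t - z) / ((of_real t - z) ^ k * sin (of_real pi * z)))"
        using nz by simp
      finally show "- exp (\<i> * of_real \<xi> * z) * (P (of_real t - z) / (of_real t - z) ^ k) / sin (of_real pi * z) = F z * (z - of_real t)"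
        by simp
    qed
    ultimately have "((\<lambda>z. F z * (z - of_real t)) \<longlongrightarrow> - exp (\<i> * of_real \<xi> * of_real t) * L / sin (of_real pi * of_real t)) (at (of_real t))"
      by (rule Lim_transform_eventually)
    then show "((\<lambda>z. F z * (z - of_real t)) \<longlongrightarrow> - exp (\<i> * of_real (\<xi> * t)) * L / of_real (sin (pi * t))) (at (of_real t))"
      by (simp add: sin_t' mult.assoc)
  qed
  have res_j: "residue F (of_int j) = T j / of_real (sin (pi * t))" for j
  proof (rule residue_simple')
    let ?U = "- ((\<int> - {of_int j}) \<union> {complex_of_real t})"
    have "closed ((\<int> :: complex set) - {of_int j})"
      by (rule closed_subset_Ints) auto
    then show "open ?U" by (intro open_Compl closed_Un) auto
    show "of_int j \<in> ?U" using t_int[of j] by auto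
    show "F holomorphic_on ?U - {of_int j}"
      by (rule holomorphic_on_subset[OF F_holo[of UNIV]]) auto
    define c where "c = cos (pi * of_int j)"
    have sin_pi_int: "sin (pi * of_int j) = 0" 
      using sin_times_pi_eq_0[of "of_int j :: real"] by (simp add: mult.commute)
    have cc: "c * c = 1"
      using sin_cos_squared_add[of "pi * of_int j"] unfolding c_def sin_pi_int by (simp add: power2_eq_square)
    then have c0: "c \<noteq> 0" by auto
    have cosj: "cos (of_real pi * of_int j :: complex) = of_real c"
    proof -
      have "complex_of_real pi * of_int j = of_real (pi * of_int j)" by simp
      then show ?thesis unfolding c_def by (simp only: cos_of_real)
    qed
    have sinj: "sin (of_real pi * of_int j :: complex) = 0" by (simp add: sin_zero)
    have "((\<lambda>z. sin (of_real pi * z)) has_field_derivative cos (of_real pi * of_int j) * of_real pi) (at (of_int j :: complex))"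
      by (rule derivative_eq_intros refl | simp)+
    then have sin_lim: "((\<lambda>z. sin (of_real pi * z) / (z - of_int j)) \<longlongrightarrow> of_real c * of_real pi) (at (of_int j :: complex))"
      unfolding has_field_derivative_iff sinj cosj by simp
    have "((\<lambda>z. exp (\<i> * of_real \<xi> * z) * P (of_real t - z) / (of_real t - z) ^ Suc k)
         \<longlongrightarrow> exp (\<i> * of_real \<xi> * of_int j) * P (of_real t - of_int j) / (of_real t - of_int j) ^ Suc k) (at (of_int j))"
    proof -
      have "continuous_on UNIV P" using P by (rule holomorphic_on_imp_continuous_on)
      then have "isCont P (of_real t - of_int j)" by (simp add: continuous_on_eq_continuous_at)
      then have "((\<lambda>z. P (of_real t - z)) \<longlongrightarrow> P (of_real t - of_int j)) (at (of_int j))"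
        by (rule isCont_tendsto_compose) (auto intro!: tendsto_intros)
      then show ?thesis using t_int[of j] by (intro tendsto_intros) auto
    qed
    from tendsto_divide[OF this sin_lim]
    have lim: "((\<lambda>z. exp (\<i> * of_real \<xi> * z) * P (of_real t - z) / (of_real t - z) ^ Suc k / (sin (of_real pi * z) / (z - of_int j)))
         \<longlongrightarrow> exp (\<i> * of_real \<xi> * of_int j) * P (of_real t - of_int j) / (of_real t - of_int j) ^ Suc k / (of_real c * of_real pi)) (at (of_int j))"
      using c0 by simp
    have "t - of_int j \<noteq> 0" using t_int[of j] by (metis eq_iff_diff_eq_0 of_real_of_int_eq)
    then have "sinc_pi (t - of_int j) = sin (pi * t) * c / (pi * (t - of_int j))"
      by (simp only: sinc_pi_def right_diff_distrib sin_diff sin_pi_int c_def) simp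
    also have "\<dots> = sin (pi * t) / (c * pi * (t - of_int j))"
      using cc c0 by (simp add: divide_simps mult.assoc)
    finally have snc: "sinc_pi (t - of_int j) = sin (pi * t) / (c * pi * (t - of_int j))" .
    have "T j / of_real (sin (pi * t)) = exp (\<i> * of_real \<xi> * of_int j) * P (of_real t - of_int j) / (of_real t - of_int j) ^ Suc k / (of_real c * of_real pi)"
      using sin_t by (simp add: T_def snc mult_ac)
    then show "((\<lambda>z. F z * (z - of_int j)) \<longlongrightarrow> T j / of_real (sin (pi * t))) (at (of_int j))"
      using lim by (simp add: F_def mult_ac)
  qed
  have key: "cmod ((\<Sum>j\<in>{- int N..int N}. T j) - L * exp (\<i> * of_real (\<xi> * t)))
      \<le> 4 * S * (real N + 1 / 2) / (real N - 1 / 2)\<^sup>2" if N: "N \<ge> 2" for N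
  proof -
    define \<rho> where "\<rho> = real N + 1 / 2"
    define pts where "pts = of_int ` {- int N..int N} \<union> {complex_of_real t}"
    have pts_lt: "cmod p < \<rho>" if "p \<in> pts" for p
      using that t N by (auto simp: pts_def \<rho>_def)
    have ints: "z \<in> pts" if "z \<in> \<int> \<union> {of_real t}" "cmod z < real N + 1" for z
    proof (cases "z = of_real t")
      case False
      then have "z \<in> \<int>" using that(1) by auto
      then obtain j where j: "z = of_int j" by (elim Ints_cases)
      then have "\<bar>of_int j\<bar> < real N + 1" using that(2) by simp
      then have "\<bar>j\<bar> < int N + 1" by linarith
      then have "j \<in> {- int N..int N}" by auto
      then show ?thesis using j unfolding pts_def by blast
    qed (simp add: pts_def)
    have "contour_integral (circlepath 0 \<rho>) F
        = 2 * pi * \<i> * (\<Sum>p\<in>pts. winding_number (circlepath 0 \<rho>) p * residue F p)"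
    proof (rule Residue_theorem)
      show "F holomorphic_on ball 0 (real N + 1) - pts"
        by (rule holomorphic_on_subset[OF F_holo[of UNIV]]) (use ints in auto)
      show "path_image (circlepath 0 \<rho>) \<subseteq> ball 0 (real N + 1) - pts"
        using pts_lt by (force simp: \<rho>_def)
      show "\<forall>z. z \<notin> ball 0 (real N + 1) \<longrightarrow> winding_number (circlepath 0 \<rho>) z = 0"
      proof (intro allI impI)
        fix z assume "z \<notin> ball (0::complex) (real N + 1)"
        then show "winding_number (circlepath 0 \<rho>) z = 0"
          by (intro winding_number_zero_outside[of _ "ball 0 (real N + 1)"]) (auto simp: \<rho>_def)
      qed
    qed (auto simp: pts_def)
    also have "(\<Sum>p\<in>pts. winding_number (circlepath 0 \<rho>) p * residue F p) = (\<Sum>p\<in>pts. residue F p)"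
      by (intro sum.cong refl) (simp add: winding_number_circlepath pts_lt)
    also have "\<dots> = (\<Sum>j\<in>{- int N..int N}. residue F (of_int j)) + residue F (of_real t)"
    proof -
      have "of_real t \<notin> (of_int ` {- int N..int N} :: complex set)" using t_int by auto
      then show ?thesis
        unfolding pts_def by (subst sum.union_disjoint) (auto simp: sum.reindex inj_on_def)
    qed
    also have "\<dots> = ((\<Sum>j\<in>{- int N..int N}. T j) - L * exp (\<i> * of_real (\<xi> * t))) / of_real (sin (pi * t))"
      by (simp add: res_t res_j sum_divide_distrib[symmetric] diff_divide_distrib mult.commute)
    finally have ci: "contour_integral (circlepath 0 \<rho>) F
       = 2 * pi * \<i> * (((\<Sum>j\<in>{- int N..int N}. T j) - L * exp (\<i> * of_real (\<xi> * t))) / of_real (sin (pi * t)))" .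
    have "cmod (contour_integral (circlepath 0 \<rho>) F) \<le> 4 * S / (real N - 1 / 2)\<^sup>2 * (2 * pi * \<rho>)"
    proof (rule has_contour_integral_bound_circlepath)
      have "continuous_on (path_image (circlepath 0 \<rho>)) F"
        by (rule holomorphic_on_imp_continuous_on, rule holomorphic_on_subset[OF F_holo[of UNIV]])
           (use ints pts_lt in \<open>force simp: \<rho>_def\<close>)
      then show "(F has_contour_integral contour_integral (circlepath 0 \<rho>) F) (circlepath 0 \<rho>)"
        by (intro has_contour_integral_integral contour_integrable_continuous_circlepath)
    next
      fix z :: complex assume "cmod (z - 0) = \<rho>"
      then have z: "cmod z = \<rho>" by simp
      have sn: "exp (pi * \<bar>Im z\<bar>) \<le> 4 * cmod (sin (of_real pi * z))"
        using z N by (intro norm_sin_circle_ge) (auto simp: \<rho>_def)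
      have tz: "real N - 1 / 2 \<le> cmod (of_real t - z)"
        using norm_triangle_ineq2[of z "of_real t"] z t by (simp add: \<rho>_def norm_minus_commute)
      have "(real N - 1 / 2)\<^sup>2 \<le> (cmod (of_real t - z))\<^sup>2"
        using tz N by (intro power_mono) auto
      also have "\<dots> \<le> cmod (of_real t - z) ^ Suc k"
        using tz N k by (intro power_increasing) auto
      finally have den: "(real N - 1 / 2)\<^sup>2 \<le> cmod (of_real t - z) ^ Suc k" .
      have "cmod (exp (\<i> * of_real \<xi> * z)) = exp (- \<xi> * Im z)" by simp
      also have "\<dots> \<le> exp (\<bar>\<xi>\<bar> * \<bar>Im z\<bar>)"
        using abs_ge_minus_self[of "\<xi> * Im z"] by (simp add: abs_mult)
      finally have e1: "cmod (exp (\<i> * of_real \<xi> * z)) \<le> exp (\<bar>\<xi>\<bar> * \<bar>Im z\<bar>)" .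
      have e2: "cmod (P (of_real t - z)) \<le> S * exp (D * \<bar>Im z\<bar>)"
        using growth[of "of_real t - z"] by simp
      have "cmod (exp (\<i> * of_real \<xi> * z)) * cmod (P (of_real t - z))
          \<le> exp (\<bar>\<xi>\<bar> * \<bar>Im z\<bar>) * (S * exp (D * \<bar>Im z\<bar>))"
        by (intro mult_mono e1 e2) auto
      also have "\<dots> = S * exp ((\<bar>\<xi>\<bar> + D) * \<bar>Im z\<bar>)"
        by (simp add: distrib_right exp_add)
      also have "\<dots> \<le> S * exp (pi * \<bar>Im z\<bar>)"
        using S \<xi> by (intro mult_left_mono) (auto intro: mult_right_mono)
      also have "\<dots> \<le> S * (4 * cmod (sin (of_real pi * z)))"
        using S sn by (intro mult_left_mono)
      finally have num: "cmod (exp (\<i> * of_real \<xi> * z)) * cmod (P (of_real t - z)) \<le> 4 * S * cmod (sin (of_real pi * z))"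
        by simp
      have spos: "0 < cmod (sin (of_real pi * z))"
        using sn exp_gt_zero[of "pi * \<bar>Im z\<bar>"] by linarith
      have "cmod (F z) = cmod (exp (\<i> * of_real \<xi> * z)) * cmod (P (of_real t - z)) / (cmod (of_real t - z) ^ Suc k * cmod (sin (of_real pi * z)))"
        by (simp only: F_def norm_divide norm_mult norm_power)
      also have "\<dots> \<le> 4 * S * cmod (sin (of_real pi * z)) / ((real N - 1 / 2)\<^sup>2 * cmod (sin (of_real pi * z)))"
        using num den spos S N by (intro frac_le mult_right_mono mult_pos_pos) auto
      also have "\<dots> = 4 * S / (real N - 1 / 2)\<^sup>2" using spos by simp
      finally show "cmod (F z) \<le> 4 * S / (real N - 1 / 2)\<^sup>2" .
    qed (use S N in \<open>auto simp: \<rho>_def\<close>)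
    moreover have "cmod (contour_integral (circlepath 0 \<rho>) F)
       = 2 * pi * (cmod ((\<Sum>j\<in>{- int N..int N}. T j) - L * exp (\<i> * of_real (\<xi> * t))) / sin (pi * t))"
      unfolding ci using sin_t by (simp add: norm_mult norm_divide)
    ultimately have "2 * pi * (cmod ((\<Sum>j\<in>{- int N..int N}. T j) - L * exp (\<i> * of_real (\<xi> * t))) / sin (pi * t))
        \<le> 2 * pi * (4 * S / (real N - 1 / 2)\<^sup>2 * \<rho>)"
      by (simp only: mult_ac)
    then have "cmod ((\<Sum>j\<in>{- int N..int N}. T j) - L * exp (\<i> * of_real (\<xi> * t))) / sin (pi * t)
        \<le> 4 * S / (real N - 1 / 2)\<^sup>2 * \<rho>"
      by (rule mult_left_le_imp_le) simp
    then have "cmod ((\<Sum>j\<in>{- int N..int N}. T j) - L * exp (\<i> * of_real (\<xi> * t)))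
        \<le> 4 * S / (real N - 1 / 2)\<^sup>2 * \<rho> * sin (pi * t)"
      using sin_t by (simp add: pos_divide_le_eq)
    also have "\<dots> \<le> 4 * S / (real N - 1 / 2)\<^sup>2 * \<rho> * 1"
      using S by (intro mult_left_mono) (auto simp: \<rho>_def)
    finally show ?thesis by (simp add: \<rho>_def)
  qed
  have "(\<lambda>N. (\<Sum>j\<in>{- int N..int N}. T j) - L * exp (\<i> * of_real (\<xi> * t))) \<longlonglongrightarrow> 0"
  proof (rule Lim_null_comparison)
    show "\<forall>\<^sub>F N in sequentially. cmod ((\<Sum>j\<in>{- int N..int N}. T j) - L * exp (\<i> * of_real (\<xi> * t)))
      \<le> 4 * S * (real N + 1 / 2) / (real N - 1 / 2)\<^sup>2"
      using key eventually_ge_at_top[of 2] by (rule eventually_mono[rotated])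
    show "(\<lambda>N. 4 * S * (real N + 1 / 2) / (real N - 1 / 2)\<^sup>2) \<longlonglongrightarrow> 0"
      by real_asymp
  qed
  then show ?thesis unfolding T_def by (rule LIM_zero_cancel)
qed

section \<open>Sampling exponentials with the spline window\<close>

text \<open>An exponential sum whose moments of order less than \<open>k\<close> vanish has a zero of order \<open>k\<close> at the
origin; the first surviving term of its Taylor expansion is the moment of order \<open>k\<close>.\<close>
lemma exp_combination_limit:
  fixes w a :: "nat \<Rightarrow> complex"
  assumes "finite A" and mom: "\<And>l. l < k \<Longrightarrow> (\<Sum>j\<in>A. w j * a j ^ l) = 0"
  shows "((\<lambda>s. (\<Sum>j\<in>A. w j * exp (a j * s)) / s ^ k) \<longlongrightarrow> (\<Sum>j\<in>A. w j * a j ^ k) / fact k) (at 0)"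
proof -
  define r where "r b s = (exp (b * s) - (\<Sum>i\<le>k. (b * s) ^ i / fact i)) / s ^ k" for b s :: complex
  have r0: "(r b \<longlongrightarrow> 0) (at 0)" for b
  proof (rule Lim_null_comparison)
    show "\<forall>\<^sub>F s in at 0. norm (r b s) \<le> exp (norm (b * s)) * norm b ^ Suc k * norm s / fact k"
      unfolding eventually_at_filter
    proof (intro always_eventually allI impI)
      fix s :: complex assume s: "s \<noteq> 0"
      have "norm (exp (b * s) - (\<Sum>i\<le>k. (b * s) ^ i / fact i)) / norm s ^ k
          \<le> exp (norm (b * s)) * (norm (b * s) ^ Suc k) / fact k / norm s ^ k"
        by (intro divide_right_mono Taylor_exp_field) auto
      also have "\<dots> = exp (norm (b * s)) * norm b ^ Suc k * norm s / fact k"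
        using s by (simp add: norm_mult power_mult_distrib field_simps)
      finally show "norm (r b s) \<le> exp (norm (b * s)) * norm b ^ Suc k * norm s / fact k"
        by (simp add: r_def norm_divide norm_power)
    qed
    show "((\<lambda>s. exp (norm (b * s)) * norm b ^ Suc k * norm s / fact k) \<longlongrightarrow> 0) (at 0)"
      by (auto intro!: tendsto_eq_intros)
  qed
  have "((\<lambda>s. (\<Sum>j\<in>A. w j * r (a j) s) + (\<Sum>j\<in>A. w j * a j ^ k) / fact k)
      \<longlongrightarrow> (\<Sum>j\<in>A. w j * 0) + (\<Sum>j\<in>A. w j * a j ^ k) / fact k) (at 0)"
    by (intro tendsto_intros r0)
  moreover have "\<forall>\<^sub>F s in at 0. (\<Sum>j\<in>A. w j * r (a j) s) + (\<Sum>j\<in>A. w j * a j ^ k) / fact k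
      = (\<Sum>j\<in>A. w j * exp (a j * s)) / s ^ k"
    unfolding eventually_at_filter
  proof (intro always_eventually allI impI)
    fix s :: complex assume s: "s \<noteq> 0"
    have "(\<Sum>j\<in>A. w j * (\<Sum>i\<le>k. (a j * s) ^ i / fact i)) = (\<Sum>i\<le>k. (\<Sum>j\<in>A. w j * a j ^ i) * (s ^ i / fact i))"
    proof -
      have "(\<Sum>j\<in>A. w j * (\<Sum>i\<le>k. (a j * s) ^ i / fact i)) = (\<Sum>j\<in>A. \<Sum>i\<le>k. w j * a j ^ i * (s ^ i / fact i))"
        by (simp add: sum_distrib_left power_mult_distrib mult_ac)
      also have "\<dots> = (\<Sum>i\<le>k. \<Sum>j\<in>A. w j * a j ^ i * (s ^ i / fact i))" by (rule sum.swap)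
      finally show ?thesis by (simp only: sum_distrib_right)
    qed
    also have "\<dots> = (\<Sum>i\<in>{k}. (\<Sum>j\<in>A. w j * a j ^ i) * (s ^ i / fact i))"
      by (rule sum.mono_neutral_right) (auto simp: mom)
    finally have T: "(\<Sum>j\<in>A. w j * (\<Sum>i\<le>k. (a j * s) ^ i / fact i)) = (\<Sum>j\<in>A. w j * a j ^ k) * (s ^ k / fact k)"
      by simp
    have "(\<Sum>j\<in>A. w j * r (a j) s) = ((\<Sum>j\<in>A. w j * exp (a j * s)) - (\<Sum>j\<in>A. w j * (\<Sum>i\<le>k. (a j * s) ^ i / fact i))) / s ^ k"
      by (simp only: r_def times_divide_eq_right right_diff_distrib sum_subtractf sum_divide_distrib[symmetric])
    then show "(\<Sum>j\<in>A. w j * r (a j) s) + (\<Sum>j\<in>A. w j * a j ^ k) / fact k = (\<Sum>j\<in>A. w j * exp (a j * s)) / s ^ k"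
      using s unfolding T by (simp add: diff_divide_distrib)
  qed
  ultimately show ?thesis using Lim_transform_eventually by fastforce
qed

text \<open>The entire function \<open>P\<close> with \<open>spline_ft \<delta> k z = P z / z\<^sup>k\<close> away from 0. Working with it avoids the removable
singularity of the spline transform.\<close>
definition spline_numerator :: "real \<Rightarrow> nat \<Rightarrow> complex \<Rightarrow> complex" where
  "spline_numerator \<delta> k z = 1 / (complex_of_real (sqrt (2 * pi)) * (\<i> * complex_of_real (pi - \<delta>)) ^ k) *
     (\<Sum>j\<le>k. ((-1) ^ (k - j) * complex_of_real (spline_coeff k j)) *
        exp (- \<i> * complex_of_real (knot k j * (pi - \<delta>)) * z))"

lemma spline_ft_eq_numerator:
  assumes "\<xi> \<noteq> 0"
  shows "spline_ft \<delta> k \<xi> = spline_numerator \<delta> k (of_real \<xi>) / of_real \<xi> ^ k"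
  using assms by (simp add: spline_ft_def spline_ft_formula_def spline_numerator_def power_mult_distrib mult_ac)

text \<open>The knots lie in \<open>[-1, 1]\<close>, so the exponentials have type at most \<open>\<pi> - \<delta>\<close>, and the
coefficients are nonnegative with known sum.\<close>
lemma norm_spline_numerator_le:
  assumes "k \<ge> 1" "\<delta> < pi"
  shows "cmod (spline_numerator \<delta> k z)
    \<le> 2 ^ (k - 1) * fact k / (pi - \<delta>) ^ k * exp ((pi - \<delta>) * \<bar>Im z\<bar>)"
proof -
  let ?D = "pi - \<delta>"
  have "cmod (\<Sum>j\<le>k. ((-1) ^ (k - j) * complex_of_real (spline_coeff k j)) * exp (- \<i> * complex_of_real (knot k j * ?D) * z))
      \<le> (\<Sum>j\<le>k. spline_coeff k j * exp (?D * \<bar>Im z\<bar>))"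
  proof (intro sum_norm_le)
    fix j
    have "\<bar>knot k j * Im z\<bar> \<le> 1 * \<bar>Im z\<bar>"
      unfolding abs_mult by (intro mult_right_mono) (auto simp: knot_def)
    then have "knot k j * Im z \<le> \<bar>Im z\<bar>" by linarith
    then have "?D * (knot k j * Im z) \<le> ?D * \<bar>Im z\<bar>" using assms by (intro mult_left_mono) auto
    then have "cmod (exp (- \<i> * complex_of_real (knot k j * ?D) * z)) \<le> exp (?D * \<bar>Im z\<bar>)"
      by (simp add: mult_ac)
    moreover have "0 \<le> spline_coeff k j"
      using assms by (simp add: spline_coeff_eq perfect_coeff_nonneg)
    ultimately show "cmod (((-1) ^ (k - j) * complex_of_real (spline_coeff k j)) * exp (- \<i> * complex_of_real (knot k j * ?D) * z))
        \<le> spline_coeff k j * exp (?D * \<bar>Im z\<bar>)"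
      unfolding norm_mult norm_power by (simp add: mult_left_mono)
  qed
  also have "\<dots> = spline_mass k * exp (?D * \<bar>Im z\<bar>)"
    using assms by (simp add: spline_coeff_eq sum_perfect_coeff flip: sum_distrib_right)
  finally have *: "cmod (\<Sum>j\<le>k. ((-1) ^ (k - j) * complex_of_real (spline_coeff k j)) * exp (- \<i> * complex_of_real (knot k j * ?D) * z))
      \<le> spline_mass k * exp (?D * \<bar>Im z\<bar>)" .
  have "cmod (spline_numerator \<delta> k z) = 1 / (sqrt (2 * pi) * ?D ^ k) *
      cmod (\<Sum>j\<le>k. ((-1) ^ (k - j) * complex_of_real (spline_coeff k j)) * exp (- \<i> * complex_of_real (knot k j * ?D) * z))"
    using assms by (simp only: spline_numerator_def norm_mult norm_divide norm_power norm_one norm_ii norm_of_real) simp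
  also have "\<dots> \<le> 1 / (sqrt (2 * pi) * ?D ^ k) * (spline_mass k * exp (?D * \<bar>Im z\<bar>))"
    using assms by (intro mult_left_mono *) auto
  also have "\<dots> = 2 ^ (k - 1) * fact k / ?D ^ k * exp (?D * \<bar>Im z\<bar>)"
    by (simp add: spline_mass_def)
  finally show ?thesis .
qed

lemma spline_numerator_limit:
  assumes "k \<ge> 1" "\<delta> < pi"
  shows "((\<lambda>s. spline_numerator \<delta> k s / s ^ k) \<longlongrightarrow> 1) (at 0)"
proof -
  let ?D = "pi - \<delta>"
  define w where "w j = (-1) ^ (k - j) * complex_of_real (spline_coeff k j)" for j
  define b where "b = - \<i> * complex_of_real ?D"
  define a where "a j = complex_of_real (knot k j) * b" for j
  have a: "a j = - \<i> * complex_of_real (knot k j * ?D)" for j by (simp add: a_def b_def)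
  define c where "c = 1 / (complex_of_real (sqrt (2 * pi)) * (\<i> * complex_of_real ?D) ^ k)"
  have mom: "(\<Sum>j\<le>k. w j * a j ^ l) = (if l = k then b ^ k * ((-1) ^ k * sqrt (2 * pi) * fact k) else 0)"
    if "l \<le> k" for l
  proof -
    have "(\<Sum>j\<le>k. w j * a j ^ l) = b ^ l *
        complex_of_real (\<Sum>j\<le>k. (-1) ^ (k - j) * spline_coeff k j * knot k j ^ l)"
      by (simp add: w_def a_def sum_distrib_left power_mult_distrib mult_ac)
    then show ?thesis
      using that assms(1) by (simp add: spline_coeff_eq perfect_coeff_moment)
  qed
  have "((\<lambda>s. c * ((\<Sum>j\<le>k. w j * exp (a j * s)) / s ^ k)) \<longlongrightarrow> c * ((\<Sum>j\<le>k. w j * a j ^ k) / fact k)) (at 0)"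
    by (intro tendsto_mult tendsto_const exp_combination_limit) (auto simp: mom)
  moreover have "c * ((\<Sum>j\<le>k. w j * a j ^ k) / fact k) = 1"
  proof -
    have "b ^ k * (-1) ^ k = (\<i> * complex_of_real ?D) ^ k"
      by (simp add: b_def flip: power_mult_distrib)
    moreover have "(\<i> * complex_of_real ?D) ^ k \<noteq> 0" using assms by simp
    ultimately show ?thesis
      by (simp add: mom c_def mult.assoc[symmetric])
  qed
  moreover have "spline_numerator \<delta> k s / s ^ k = c * ((\<Sum>j\<le>k. w j * exp (a j * s)) / s ^ k)" for s
    by (simp only: spline_numerator_def w_def a c_def times_divide_eq_right)
  ultimately show ?thesis by (simp only:)
qed

lemma norm_spline_ft_le:
  assumes "k \<ge> 1" "\<delta> < pi" "\<xi> \<noteq> 0"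
  shows "cmod (spline_ft \<delta> k \<xi>) \<le> 2 ^ (k - 1) * fact k / ((pi - \<delta>) ^ k * \<bar>\<xi>\<bar> ^ k)"
proof -
  have "cmod (spline_ft \<delta> k \<xi>) = cmod (spline_numerator \<delta> k (of_real \<xi>)) / \<bar>\<xi>\<bar> ^ k"
    using assms(3) by (simp add: spline_ft_eq_numerator norm_divide norm_power)
  also have "\<dots> \<le> 2 ^ (k - 1) * fact k / (pi - \<delta>) ^ k / \<bar>\<xi>\<bar> ^ k"
    using norm_spline_numerator_le[OF assms(1,2), of "of_real \<xi>"] by (intro divide_right_mono) auto
  finally show ?thesis by simp
qed

text \<open>The sampling formula for a single frequency. It is asserted for symmetric partial sums only,
which is the form in which the residue theorem delivers it.\<close>
lemma spline_sampling_exponential: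
  assumes k: "k \<ge> 1" and \<delta>: "\<delta> < pi" and \<xi>: "\<bar>\<xi>\<bar> \<le> \<delta>" and t: "0 < t" "t < 1"
  shows "(\<lambda>N. \<Sum>j\<in>{- int N..int N}. of_real (sinc_pi (t - of_int j)) * spline_ft \<delta> k (t - of_int j)
            * exp (\<i> * of_real \<xi> * of_int j)) \<longlonglongrightarrow> exp (\<i> * of_real (\<xi> * t))"
proof -
  have nz: "t - of_int j \<noteq> 0" for j
    using t by (metis diff_eq_eq add_0 of_int_0_less_iff of_int_less_1_iff zless_add1_eq int_one_le_iff_zero_less not_le)
  have "(\<lambda>N. \<Sum>j\<in>{- int N..int N}. of_real (sinc_pi (t - of_int j)) *
            (spline_numerator \<delta> k (of_real (t - of_int j)) / of_real (t - of_int j) ^ k) * exp (\<i> * of_real \<xi> * of_int j))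
         \<longlonglongrightarrow> 1 * exp (\<i> * of_real (\<xi> * t))"
  proof (rule sampling_series_limit)
    show "spline_numerator \<delta> k holomorphic_on UNIV"
      unfolding spline_numerator_def[abs_def] by (intro holomorphic_intros)
    show "cmod (spline_numerator \<delta> k z) \<le> 2 ^ (k - 1) * fact k / (pi - \<delta>) ^ k * exp ((pi - \<delta>) * \<bar>Im z\<bar>)" for z
      by (rule norm_spline_numerator_le[OF k \<delta>])
    show "((\<lambda>s. spline_numerator \<delta> k s / s ^ k) \<longlongrightarrow> 1) (at 0)"
      by (rule spline_numerator_limit[OF k \<delta>])
  qed (use assms in auto)
  then show ?thesis by (simp only: spline_ft_eq_numerator[OF nz] mult_1_left)
qed

section \<open>Plancherel theory for truncated Fourier integrals\<close>

lemma square_integrable_imp_integrable_mult: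
  assumes "square_integrable M f" "square_integrable M g"
  shows "integrable M (\<lambda>x. f x * g x)"
proof (rule Bochner_Integration.integrable_bound)
  show "integrable M (\<lambda>x. (cmod (f x))\<^sup>2 + (cmod (g x))\<^sup>2)"
    using assms by (auto simp: square_integrable_def)
  show "(\<lambda>x. f x * g x) \<in> borel_measurable M"
    using assms by (auto simp: square_integrable_def)
  have "a * b \<le> a\<^sup>2 + b\<^sup>2" if "0 \<le> a" "0 \<le> b" for a b :: real
    using sum_squares_bound[of a b] mult_nonneg_nonneg[OF that] by simp
  then show "AE x in M. norm (f x * g x) \<le> norm ((cmod (f x))\<^sup>2 + (cmod (g x))\<^sup>2)"
    by (intro AE_I2) (auto simp: norm_mult)
qed

lemma square_integrable_nn_integral:
  assumes "square_integrable M f"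
  shows "(\<integral>\<^sup>+x. ennreal (cmod (f x)) ^ 2 \<partial>M) = ennreal ((L2_norm M f)\<^sup>2)"
proof -
  have "(\<integral>\<^sup>+x. ennreal (cmod (f x)) ^ 2 \<partial>M) = (\<integral>\<^sup>+x. ennreal ((cmod (f x))\<^sup>2) \<partial>M)"
    by (simp add: ennreal_power)
  also have "\<dots> = ennreal (LINT x|M. (cmod (f x))\<^sup>2)"
    using assms by (intro nn_integral_eq_integral) (auto simp: square_integrable_def)
  finally show ?thesis by (simp add: L2_norm_def)
qed

lemma L2_Cauchy_Schwarz:
  assumes f: "square_integrable M f" and g: "square_integrable M g"
  shows "(LINT x|M. cmod (f x) * cmod (g x)) \<le> L2_norm M f * L2_norm M g"
proof -
  have [measurable]: "f \<in> borel_measurable M" "g \<in> borel_measurable M"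
    using assms by (auto simp: square_integrable_def)
  have int: "integrable M (\<lambda>x. cmod (f x) * cmod (g x))"
    using integrable_norm[OF square_integrable_imp_integrable_mult[OF f g]] by (simp add: norm_mult)
  have nn: "0 \<le> L2_norm M f" "0 \<le> L2_norm M g" by (auto simp: L2_norm_def)
  have "ennreal ((LINT x|M. cmod (f x) * cmod (g x))\<^sup>2) = (\<integral>\<^sup>+x. ennreal (cmod (f x)) * ennreal (cmod (g x)) \<partial>M)\<^sup>2"
  proof -
    have "(\<integral>\<^sup>+x. ennreal (cmod (f x)) * ennreal (cmod (g x)) \<partial>M) = (\<integral>\<^sup>+x. ennreal (cmod (f x) * cmod (g x)) \<partial>M)"
      by (simp add: ennreal_mult)
    also have "\<dots> = ennreal (LINT x|M. cmod (f x) * cmod (g x))"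
      by (rule nn_integral_eq_integral[OF int]) simp
    finally show ?thesis by (simp add: ennreal_power)
  qed
  also have "\<dots> \<le> (\<integral>\<^sup>+x. ennreal (cmod (f x)) ^ 2 \<partial>M) * (\<integral>\<^sup>+x. ennreal (cmod (g x)) ^ 2 \<partial>M)"
    by (rule Cauchy_Schwarz_nn_integral) auto
  also have "\<dots> = ennreal ((L2_norm M f * L2_norm M g)\<^sup>2)"
    by (simp add: square_integrable_nn_integral[OF f] square_integrable_nn_integral[OF g] power_mult_distrib ennreal_mult)
  finally have "(LINT x|M. cmod (f x) * cmod (g x))\<^sup>2 \<le> (L2_norm M f * L2_norm M g)\<^sup>2"
    by (subst (asm) ennreal_le_iff) auto
  then show ?thesis
    by (rule power2_le_imp_le) (use nn in simp)
qed

text \<open>The multiplication formula \<open>\<integral> f\<^sup>\<and> \<phi> = \<integral> f \<phi>\<^sup>\<and>\<close>. It is the only place where integrals are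
interchanged: with a Gaussian for \<open>\<phi>\<close> it gives Fourier inversion, and with the conjugate of the
transform itself it gives Plancherel's identity.\<close>
lemma fourier_trunc_multiplication:
  fixes f \<phi> :: "real \<Rightarrow> complex"
  assumes f: "continuous_on UNIV f" and \<phi>: "integrable lborel \<phi>"
  shows "integrable lborel (\<lambda>\<xi>. fourier_trunc T f \<xi> * \<phi> \<xi>)"
    and "(LINT \<xi>|lborel. fourier_trunc T f \<xi> * \<phi> \<xi>) = complex_of_real (1 / sqrt (2 * pi)) *
      (LINT t:{-T..T}|lborel. f t * (LINT \<xi>|lborel. \<phi> \<xi> * exp (- \<i> * complex_of_real (t * \<xi>))))"
proof -
  have [measurable]: "f \<in> borel_measurable borel" using f by (rule borel_measurable_continuous_onI)
  have [measurable]: "\<phi> \<in> borel_measurable borel" using \<phi> by auto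
  define H where "H \<xi> t = indicator {-T..T} t *\<^sub>R (f t * exp (- \<i> * complex_of_real (t * \<xi>)) * \<phi> \<xi>)" for \<xi> t
  have H_meas [measurable]: "case_prod H \<in> borel_measurable (lborel \<Otimes>\<^sub>M lborel)"
    unfolding H_def by measurable
  have ind: "integrable lborel (\<lambda>t. indicator {-T..T} t *\<^sub>R f t)"
    using borel_integrable_compact[of "{-T..T}" f] f continuous_on_subset by (auto simp: set_integrable_def)
  have nH: "norm (H \<xi> t) = norm (indicator {-T..T} t *\<^sub>R f t) * norm (\<phi> \<xi>)" for \<xi> t
    by (simp add: H_def norm_mult)
  have H_int: "integrable (lborel \<Otimes>\<^sub>M lborel) (case_prod H)"
  proof (rule lborel_pair.Fubini_integrable[OF H_meas])
    show "integrable lborel (\<lambda>x. LINT y|lborel. norm (case (x, y) of (x, y) \<Rightarrow> H x y))"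
      using \<phi> by (simp add: nH)
    show "AE x in lborel. integrable lborel (\<lambda>y. case (x, y) of (x, y) \<Rightarrow> H x y)"
    proof (rule AE_I2)
      fix \<xi> :: real
      have "(\<lambda>y. H \<xi> y) \<in> borel_measurable lborel" unfolding H_def by measurable
      then show "integrable lborel (\<lambda>y. case (\<xi>, y) of (x, y) \<Rightarrow> H x y)"
        unfolding case_prod_conv
        by (rule Bochner_Integration.integrable_bound[OF integrable_mult_left[OF integrable_norm[OF ind], of "norm (\<phi> \<xi>)"]])
           (simp add: nH)
    qed
  qed
  have inner: "(LINT t|lborel. H \<xi> t) = sqrt (2 * pi) * (fourier_trunc T f \<xi> * \<phi> \<xi>)" for \<xi>
  proof -
    have "(LINT t|lborel. H \<xi> t) = (LINT t|lborel. indicator {-T..T} t *\<^sub>R (f t * exp (- \<i> * complex_of_real (t * \<xi>))) * \<phi> \<xi>)"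
      by (simp add: H_def)
    also have "\<dots> = (LINT t:{-T..T}|lborel. f t * exp (- \<i> * complex_of_real (t * \<xi>))) * \<phi> \<xi>"
      unfolding set_lebesgue_integral_def by (rule integral_mult_left_zero)
    finally show ?thesis by (simp add: fourier_trunc_def)
  qed
  have "integrable lborel (\<lambda>\<xi>. LINT t|lborel. H \<xi> t)"
    using lborel_pair.integrable_fst[OF H_int] by simp
  from integrable_mult_right[OF this, of "complex_of_real (1 / sqrt (2 * pi))"]
  show "integrable lborel (\<lambda>\<xi>. fourier_trunc T f \<xi> * \<phi> \<xi>)"
    by (simp add: inner)
  have "sqrt (2 * pi) * (LINT \<xi>|lborel. fourier_trunc T f \<xi> * \<phi> \<xi>) = (LINT \<xi>|lborel. LINT t|lborel. H \<xi> t)"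
    by (simp add: inner)
  also have "\<dots> = (LINT t|lborel. LINT \<xi>|lborel. H \<xi> t)"
    by (rule lborel_pair.Fubini_integral[OF H_int, symmetric])
  also have "(\<lambda>t. LINT \<xi>|lborel. H \<xi> t) = (\<lambda>t. indicator {-T..T} t *\<^sub>R (f t * (LINT \<xi>|lborel. \<phi> \<xi> * exp (- \<i> * complex_of_real (t * \<xi>)))))"
  proof
    fix t
    have "(\<lambda>\<xi>. H \<xi> t) = (\<lambda>\<xi>. (indicator {-T..T} t *\<^sub>R f t) * (\<phi> \<xi> * exp (- \<i> * complex_of_real (t * \<xi>))))"
      by (simp add: H_def fun_eq_iff)
    then show "(LINT \<xi>|lborel. H \<xi> t) = indicator {-T..T} t *\<^sub>R (f t * (LINT \<xi>|lborel. \<phi> \<xi> * exp (- \<i> * complex_of_real (t * \<xi>))))"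
      by simp
  qed
  finally have eq: "sqrt (2 * pi) * (LINT \<xi>|lborel. fourier_trunc T f \<xi> * \<phi> \<xi>)
     = (LINT t:{-T..T}|lborel. f t * (LINT \<xi>|lborel. \<phi> \<xi> * exp (- \<i> * complex_of_real (t * \<xi>))))"
    by (simp add: set_lebesgue_integral_def)
  show "(LINT \<xi>|lborel. fourier_trunc T f \<xi> * \<phi> \<xi>) = complex_of_real (1 / sqrt (2 * pi)) *
      (LINT t:{-T..T}|lborel. f t * (LINT \<xi>|lborel. \<phi> \<xi> * exp (- \<i> * complex_of_real (t * \<xi>))))"
    unfolding eq[symmetric] by simp
qed

lemma fourier_trunc_measurable [measurable]:
  assumes "continuous_on UNIV f"
  shows "fourier_trunc T f \<in> borel_measurable borel"
proof -
  have [measurable]: "f \<in> borel_measurable borel" using assms by (rule borel_measurable_continuous_onI)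
  show ?thesis unfolding fourier_trunc_def set_lebesgue_integral_def by measurable
qed

text \<open>Convergence in \<open>L\<^sup>2\<close> implies weak convergence against square-integrable test functions, by
Cauchy--Schwarz for the nonnegative integral.\<close>
lemma tendsto_integral_fourier_trunc:
  assumes f: "continuous_on UNIV f" and fg: "has_L2_fourier_transform f g"
    and \<phi>: "integrable lborel \<phi>" "square_integrable lborel \<phi>"
  shows "(\<lambda>N. LINT \<xi>|lborel. fourier_trunc (real N) f \<xi> * \<phi> \<xi>) \<longlonglongrightarrow> (LINT \<xi>|lborel. g \<xi> * \<phi> \<xi>)"
proof -
  have g: "square_integrable lborel g" using fg by (simp add: has_L2_fourier_transform_def)
  have [measurable]: "g \<in> borel_measurable borel" "\<phi> \<in> borel_measurable borel"
    using g \<phi> by (auto simp: square_integrable_def)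
  note [measurable] = fourier_trunc_measurable[OF f]
  define a where "a N = (\<integral>\<^sup>+\<xi>. ennreal ((cmod (fourier_trunc (real N) f \<xi> - g \<xi>))\<^sup>2) \<partial>lborel)" for N
  define c where "c = (\<integral>\<^sup>+\<xi>. ennreal (cmod (\<phi> \<xi>)) ^ 2 \<partial>lborel)"
  define d where "d N = (LINT \<xi>|lborel. fourier_trunc (real N) f \<xi> * \<phi> \<xi>) - (LINT \<xi>|lborel. g \<xi> * \<phi> \<xi>)" for N
  have "((\<lambda>T. \<integral>\<^sup>+\<xi>. ennreal ((cmod (fourier_trunc T f \<xi> - g \<xi>))\<^sup>2) \<partial>lborel) \<longlongrightarrow> 0) at_top"
    using fg by (simp add: has_L2_fourier_transform_def)
  then have a0: "a \<longlonglongrightarrow> 0"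
    unfolding a_def by (rule filterlim_compose[OF _ filterlim_real_sequentially])
  have c_fin: "c < top" unfolding c_def square_integrable_nn_integral[OF \<phi>(2)] by simp
  have bound: "ennreal ((cmod (d N))\<^sup>2) \<le> c * a N" for N
  proof -
    let ?h = "\<lambda>\<xi>. (fourier_trunc (real N) f \<xi> - g \<xi>) * \<phi> \<xi>"
    have int: "integrable lborel ?h"
      using Bochner_Integration.integrable_diff[OF fourier_trunc_multiplication(1)[OF f \<phi>(1), of "real N"] square_integrable_imp_integrable_mult[OF g \<phi>(2)]]
      by (simp add: left_diff_distrib)
    have "d N = (LINT \<xi>|lborel. ?h \<xi>)"
      unfolding d_def left_diff_distrib
      by (rule Bochner_Integration.integral_diff[symmetric, OF fourier_trunc_multiplication(1)[OF f \<phi>(1)] square_integrable_imp_integrable_mult[OF g \<phi>(2)]])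
    then have "ennreal (cmod (d N)) \<le> (\<integral>\<^sup>+\<xi>. ennreal (norm (?h \<xi>)) \<partial>lborel)"
      using integral_norm_bound_ennreal[OF int] by simp
    also have "\<dots> = (\<integral>\<^sup>+\<xi>. ennreal (cmod (fourier_trunc (real N) f \<xi> - g \<xi>)) * ennreal (cmod (\<phi> \<xi>)) \<partial>lborel)"
      by (simp add: norm_mult ennreal_mult)
    finally have "(ennreal (cmod (d N)))\<^sup>2 \<le> (\<integral>\<^sup>+\<xi>. ennreal (cmod (fourier_trunc (real N) f \<xi> - g \<xi>)) * ennreal (cmod (\<phi> \<xi>)) \<partial>lborel)\<^sup>2"
      by (intro power_mono) auto
    also have "\<dots> \<le> (\<integral>\<^sup>+\<xi>. ennreal (cmod (fourier_trunc (real N) f \<xi> - g \<xi>)) ^ 2 \<partial>lborel) * c"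
      unfolding c_def by (rule Cauchy_Schwarz_nn_integral) auto
    finally show ?thesis by (simp add: a_def ennreal_power mult.commute)
  qed
  have "(\<lambda>N. c * a N) \<longlonglongrightarrow> c * 0"
    by (rule ennreal_tendsto_cmult[OF c_fin a0])
  then have upper: "(\<lambda>N. c * a N) \<longlonglongrightarrow> ennreal 0" by simp
  have "(\<lambda>N. ennreal ((cmod (d N))\<^sup>2)) \<longlonglongrightarrow> ennreal 0"
  proof (rule tendsto_sandwich[OF _ _ _ upper])
    show "(\<lambda>_. 0) \<longlonglongrightarrow> ennreal 0" by simp
  qed (simp_all add: bound)
  then have "(\<lambda>N. (cmod (d N))\<^sup>2) \<longlonglongrightarrow> 0"
    by (subst (asm) tendsto_ennreal_iff) auto
  then have "(\<lambda>N. cmod (d N)) \<longlonglongrightarrow> 0"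
    using tendsto_real_sqrt[of "\<lambda>N. (cmod (d N))\<^sup>2" 0] by simp
  then have "d \<longlonglongrightarrow> 0" by (rule tendsto_norm_zero_cancel)
  then show ?thesis unfolding d_def by (rule LIM_zero_cancel)
qed

text \<open>The characteristic function of the standard normal distribution, rescaled.\<close>
lemma fourier_transform_gaussian:
  fixes \<epsilon> u :: real
  assumes "\<epsilon> > 0"
  shows "integrable lborel (\<lambda>\<xi>. exp (\<i> * complex_of_real (u * \<xi>)) * complex_of_real (exp (- (\<epsilon> * \<xi>)\<^sup>2 / 2)))"
    and "(LINT \<xi>|lborel. exp (\<i> * complex_of_real (u * \<xi>)) * complex_of_real (exp (- (\<epsilon> * \<xi>)\<^sup>2 / 2)))
       = complex_of_real (2 * pi * normal_density 0 \<epsilon> u)"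
proof -
  have std: "(LINT x|lborel. std_normal_density x *\<^sub>R exp (\<i> * complex_of_real (v * x))) = complex_of_real (exp (- v\<^sup>2 / 2))" for v
  proof -
    have "char std_normal_distribution v = (LINT x|lborel. std_normal_density x *\<^sub>R exp (\<i> * complex_of_real (v * x)))"
      unfolding char_def by (subst integral_density) auto
    then show ?thesis by (simp add: char_std_normal_distribution)
  qed
  have std_int: "integrable lborel (\<lambda>x. std_normal_density x *\<^sub>R exp (\<i> * complex_of_real (v * x)))" for v
  proof (rule Bochner_Integration.integrable_bound)
    show "integrable lborel std_normal_density" by simp
  qed auto
  let ?G = "\<lambda>\<xi>. exp (\<i> * complex_of_real (u * \<xi>)) * complex_of_real (exp (- (\<epsilon> * \<xi>)\<^sup>2 / 2))"
  have subst: "?G \<xi> = sqrt (2 * pi) * (std_normal_density (0 + \<epsilon> * \<xi>) *\<^sub>R exp (\<i> * complex_of_real (u / \<epsilon> * (0 + \<epsilon> * \<xi>))))" for \<xi>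
    using assms by (simp add: std_normal_density_def scaleR_conv_of_real mult_ac)
  show "integrable lborel ?G"
    unfolding subst using assms
    by (intro integrable_mult_right lborel_integrable_real_affine[OF std_int[of "u / \<epsilon>"]]) auto
  have "(LINT \<xi>|lborel. ?G \<xi>) = sqrt (2 * pi) *
      (LINT \<xi>|lborel. std_normal_density (0 + \<epsilon> * \<xi>) *\<^sub>R exp (\<i> * complex_of_real (u / \<epsilon> * (0 + \<epsilon> * \<xi>))))"
    unfolding subst by (rule integral_mult_right_zero)
  also have "(LINT \<xi>|lborel. std_normal_density (0 + \<epsilon> * \<xi>) *\<^sub>R exp (\<i> * complex_of_real (u / \<epsilon> * (0 + \<epsilon> * \<xi>))))
     = complex_of_real (exp (- (u / \<epsilon>)\<^sup>2 / 2)) / \<epsilon>"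
    using lborel_integral_real_affine[of \<epsilon> "\<lambda>x. std_normal_density x *\<^sub>R exp (\<i> * complex_of_real (u / \<epsilon> * x))" 0] assms
    unfolding std[of "u / \<epsilon>"] by (simp add: scaleR_conv_of_real)
  also have "sqrt (2 * pi) * (complex_of_real (exp (- (u / \<epsilon>)\<^sup>2 / 2)) / \<epsilon>) = complex_of_real (2 * pi * normal_density 0 \<epsilon> u)"
  proof -
    have "sqrt (2 * pi) * (exp (- (u / \<epsilon>)\<^sup>2 / 2) / \<epsilon>) = (sqrt (2 * pi))\<^sup>2 * (1 / (sqrt (2 * pi) * \<epsilon>) * exp (- u\<^sup>2 / (2 * \<epsilon>\<^sup>2)))"
      using assms by (simp add: power2_eq_square field_simps)
    also have "\<dots> = 2 * pi * normal_density 0 \<epsilon> u"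
      using assms by (simp add: normal_density_def real_sqrt_mult power_mult_distrib)
    finally show ?thesis by (metis of_real_divide of_real_mult)
  qed
  finally show "(LINT \<xi>|lborel. ?G \<xi>) = complex_of_real (2 * pi * normal_density 0 \<epsilon> u)" .
qed

lemma set_integral_truncation_tendsto:
  fixes h :: "real \<Rightarrow> complex"
  assumes "integrable lborel h"
  shows "(\<lambda>N. LINT t:{- real N..real N}|lborel. h t) \<longlonglongrightarrow> (LINT t|lborel. h t)"
  unfolding set_lebesgue_integral_def
proof (rule integral_dominated_convergence[where w = "\<lambda>t. norm (h t)"])
  show "AE t in lborel. (\<lambda>N. indicator {- real N..real N} t *\<^sub>R h t) \<longlonglongrightarrow> h t"
  proof (rule AE_I2)
    fix t :: real
    obtain N0 :: nat where "\<bar>t\<bar> \<le> real N0" using real_arch_simple by blast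
    then have "\<forall>\<^sub>F N in sequentially. h t = indicator {- real N..real N} t *\<^sub>R h t"
      by (intro eventually_sequentiallyI[of N0]) (auto simp: indicator_def)
    then show "(\<lambda>N. indicator {- real N..real N} t *\<^sub>R h t) \<longlonglongrightarrow> h t"
      by (rule Lim_transform_eventually[OF tendsto_const])
  qed
qed (use assms in \<open>auto simp: indicator_def\<close>)

text \<open>Tested against the modulated Gaussian \<open>exp (\<i> s \<xi> - (\<epsilon> \<xi>)\<^sup>2 / 2)\<close>, the multiplication formula turns into
an average of \<open>f\<close> over a normal distribution around \<open>s\<close> with standard deviation \<open>\<epsilon>\<close>. Letting
\<open>\<epsilon>\<close> tend to 0 recovers \<open>f s\<close>; boundedness of \<open>f\<close> provides the dominating function.\<close>
lemma L2_fourier_inversion: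
  fixes f g :: "real \<Rightarrow> complex"
  assumes f: "continuous_on UNIV f" and bdd: "\<And>t. cmod (f t) \<le> B"
    and fg: "has_L2_fourier_transform f g" and g: "integrable lborel g"
  shows "(LINT \<xi>|lborel. g \<xi> * exp (\<i> * complex_of_real (s * \<xi>))) = sqrt (2 * pi) * f s"
proof -
  have [measurable]: "f \<in> borel_measurable borel" using f by (rule borel_measurable_continuous_onI)
  have [measurable]: "g \<in> borel_measurable borel" using g by auto
  \<comment> \<open>A modulated Gaussian, so that its transform concentrates at \<open>s\<close>.\<close>
  define \<phi> where "\<phi> \<epsilon> \<xi> = exp (\<i> * complex_of_real (s * \<xi>)) * complex_of_real (exp (- (\<epsilon> * \<xi>)\<^sup>2 / 2))" for \<epsilon> \<xi>
  have smoothed: "(LINT \<xi>|lborel. g \<xi> * \<phi> \<epsilon> \<xi>) = sqrt (2 * pi) * (LINT x|lborel. std_normal_density x *\<^sub>R f (s + \<epsilon> * x))"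
    if \<epsilon>: "\<epsilon> > 0" for \<epsilon>
  proof -
    have \<phi>_int: "integrable lborel (\<phi> \<epsilon>)"
      unfolding \<phi>_def by (rule fourier_transform_gaussian(1)[OF \<epsilon>])
    have \<phi>_le: "cmod (\<phi> \<epsilon> \<xi>) \<le> 1" for \<xi> by (simp add: \<phi>_def norm_mult)
    have [measurable]: "\<phi> \<epsilon> \<in> borel_measurable borel" using \<phi>_int by auto
    have "integrable lborel (\<lambda>\<xi>. (cmod (\<phi> \<epsilon> \<xi>))\<^sup>2)"
    proof (rule Bochner_Integration.integrable_bound[OF integrable_norm[OF \<phi>_int]])
      show "AE x in lborel. norm ((cmod (\<phi> \<epsilon> x))\<^sup>2) \<le> norm (cmod (\<phi> \<epsilon> x))"
        using \<phi>_le by (intro AE_I2) (auto simp: power2_eq_square intro: mult_left_le)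
    qed auto
    then have \<phi>_sq: "square_integrable lborel (\<phi> \<epsilon>)" by (simp add: square_integrable_def)
    have ft: "(LINT \<xi>|lborel. \<phi> \<epsilon> \<xi> * exp (- \<i> * complex_of_real (t * \<xi>))) = complex_of_real (2 * pi * normal_density s \<epsilon> t)" for t
    proof -
      have "\<phi> \<epsilon> \<xi> * exp (- \<i> * complex_of_real (t * \<xi>))
         = exp (\<i> * complex_of_real ((s - t) * \<xi>)) * complex_of_real (exp (- (\<epsilon> * \<xi>)\<^sup>2 / 2))" for \<xi>
        by (simp add: \<phi>_def left_diff_distrib right_diff_distrib exp_diff exp_minus field_simps)
      moreover have "normal_density 0 \<epsilon> (s - t) = normal_density s \<epsilon> t"
        by (simp add: normal_density_def power2_commute)
      ultimately show ?thesis by (simp only: fourier_transform_gaussian(2)[OF \<epsilon>])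
    qed
    let ?h = "\<lambda>t. f t * complex_of_real (2 * pi * normal_density s \<epsilon> t)"
    have h_int: "integrable lborel ?h"
    proof (rule Bochner_Integration.integrable_bound[of lborel "\<lambda>t. B * (2 * pi * normal_density s \<epsilon> t)"])
      show "AE t in lborel. norm (?h t) \<le> norm (B * (2 * pi * normal_density s \<epsilon> t))"
        using bdd by (intro AE_I2) (auto simp: norm_mult abs_mult intro!: mult_right_mono order_trans[OF bdd abs_ge_self])
    qed (use \<epsilon> in auto)
    have "(\<lambda>N. LINT \<xi>|lborel. fourier_trunc (real N) f \<xi> * \<phi> \<epsilon> \<xi>) \<longlonglongrightarrow> (LINT \<xi>|lborel. g \<xi> * \<phi> \<epsilon> \<xi>)"
      by (rule tendsto_integral_fourier_trunc[OF f fg \<phi>_int \<phi>_sq])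
    moreover have "(\<lambda>N. LINT \<xi>|lborel. fourier_trunc (real N) f \<xi> * \<phi> \<epsilon> \<xi>) \<longlonglongrightarrow> complex_of_real (1 / sqrt (2 * pi)) * (LINT t|lborel. ?h t)"
      unfolding fourier_trunc_multiplication(2)[OF f \<phi>_int] ft
      by (intro tendsto_intros set_integral_truncation_tendsto h_int)
    ultimately have "(LINT \<xi>|lborel. g \<xi> * \<phi> \<epsilon> \<xi>) = complex_of_real (1 / sqrt (2 * pi)) * (LINT t|lborel. ?h t)"
      by (rule LIMSEQ_unique)
    also have "(LINT t|lborel. ?h t) = \<epsilon> *\<^sub>R (LINT x|lborel. ?h (s + \<epsilon> * x))"
      using lborel_integral_real_affine[of \<epsilon> ?h s] \<epsilon> by simp
    also have "(\<lambda>x. ?h (s + \<epsilon> * x)) = (\<lambda>x. complex_of_real (2 * pi / \<epsilon>) * (std_normal_density x *\<^sub>R f (s + \<epsilon> * x)))"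
      using \<epsilon> by (simp add: normal_density_def fun_eq_iff power_mult_distrib scaleR_conv_of_real real_sqrt_mult mult_ac)
    also have "complex_of_real (1 / sqrt (2 * pi)) * (\<epsilon> *\<^sub>R (LINT x|lborel. complex_of_real (2 * pi / \<epsilon>) * (std_normal_density x *\<^sub>R f (s + \<epsilon> * x))))
       = complex_of_real (1 / sqrt (2 * pi) * \<epsilon> * (2 * pi / \<epsilon>)) * (LINT x|lborel. std_normal_density x *\<^sub>R f (s + \<epsilon> * x))"
      by (simp add: scaleR_conv_of_real)
    also have "1 / sqrt (2 * pi) * \<epsilon> * (2 * pi / \<epsilon>) = sqrt (2 * pi)"
      using \<epsilon> by (simp add: real_div_sqrt)
    finally show ?thesis .
  qed
  define e where "e n = 1 / real (Suc n)" for n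
  have e0: "e \<longlonglongrightarrow> 0" unfolding e_def by (rule LIMSEQ_Suc[OF lim_1_over_n])
  have "(\<lambda>n. LINT \<xi>|lborel. g \<xi> * \<phi> (e n) \<xi>) \<longlonglongrightarrow> (LINT \<xi>|lborel. g \<xi> * exp (\<i> * complex_of_real (s * \<xi>)))"
  proof (rule integral_dominated_convergence[where w = "\<lambda>\<xi>. norm (g \<xi>)"])
    show "AE \<xi> in lborel. (\<lambda>n. g \<xi> * \<phi> (e n) \<xi>) \<longlonglongrightarrow> g \<xi> * exp (\<i> * complex_of_real (s * \<xi>))"
      unfolding \<phi>_def by (intro AE_I2) (auto intro!: tendsto_eq_intros e0)
    show "AE \<xi> in lborel. norm (g \<xi> * \<phi> (e n) \<xi>) \<le> norm (g \<xi>)" for n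
      unfolding \<phi>_def by (intro AE_I2) (auto simp: norm_mult intro!: mult_left_le)
  qed (use g in \<open>auto simp: \<phi>_def\<close>)
  moreover have "(\<lambda>n. LINT \<xi>|lborel. g \<xi> * \<phi> (e n) \<xi>) \<longlonglongrightarrow> sqrt (2 * pi) * f s"
  proof -
    have "(\<lambda>n. LINT x|lborel. std_normal_density x *\<^sub>R f (s + e n * x)) \<longlonglongrightarrow> (LINT x|lborel. std_normal_density x *\<^sub>R f s)"
    proof (rule integral_dominated_convergence[where w = "\<lambda>x. B * std_normal_density x"])
      show "AE x in lborel. (\<lambda>n. std_normal_density x *\<^sub>R f (s + e n * x)) \<longlonglongrightarrow> std_normal_density x *\<^sub>R f s"
      proof (rule AE_I2)
        fix x
        have "isCont f s" using f by (simp add: continuous_on_eq_continuous_at)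
        moreover have "(\<lambda>n. s + e n * x) \<longlonglongrightarrow> s" by (auto intro!: tendsto_eq_intros e0)
        ultimately have "(\<lambda>n. f (s + e n * x)) \<longlonglongrightarrow> f s" by (rule isCont_tendsto_compose)
        then show "(\<lambda>n. std_normal_density x *\<^sub>R f (s + e n * x)) \<longlonglongrightarrow> std_normal_density x *\<^sub>R f s"
          by (intro tendsto_intros)
      qed
      show "AE x in lborel. norm (std_normal_density x *\<^sub>R f (s + e n * x)) \<le> B * std_normal_density x" for n
        using bdd by (intro AE_I2) (simp add: mult.commute[of B] mult_left_mono)
    qed auto
    then have "(\<lambda>n. sqrt (2 * pi) * (LINT x|lborel. std_normal_density x *\<^sub>R f (s + e n * x))) \<longlonglongrightarrow> sqrt (2 * pi) * f s"
      by (intro tendsto_intros) simp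
    moreover have "e n > 0" for n by (simp add: e_def)
    ultimately show ?thesis by (simp only: smoothed)
  qed
  ultimately show ?thesis by (rule LIMSEQ_unique)
qed

text \<open>The multiplication formula with the conjugate of \<open>g\<close> as test function, whose transform is the
conjugate of \<open>f\<close> by inversion.\<close>
lemma L2_fourier_plancherel:
  fixes f g :: "real \<Rightarrow> complex"
  assumes f: "continuous_on UNIV f" and bdd: "\<And>t. cmod (f t) \<le> B"
    and fg: "has_L2_fourier_transform f g" and g: "integrable lborel g"
  shows "L2_norm lborel g = L2_norm lborel f"
proof -
  have sq: "square_integrable lborel f" "square_integrable lborel g"
    using fg by (auto simp: has_L2_fourier_transform_def)
  have cg1: "integrable lborel (\<lambda>\<xi>. cnj (g \<xi>))" using g by simp
  have cg2: "square_integrable lborel (\<lambda>\<xi>. cnj (g \<xi>))"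
    using borel_measurable_integrable[OF cg1] sq(2) by (simp add: square_integrable_def)
  have "(\<lambda>t. complex_of_real (sqrt (2 * pi)) * cnj (f t)) \<in> borel_measurable borel"
    using f by (intro borel_measurable_continuous_onI continuous_intros)
  then have cf: "square_integrable lborel (\<lambda>t. complex_of_real (sqrt (2 * pi)) * cnj (f t))"
    using sq(1) by (simp add: square_integrable_def norm_mult power_mult_distrib)
  have ft: "(LINT \<xi>|lborel. cnj (g \<xi>) * exp (- \<i> * complex_of_real (t * \<xi>))) = sqrt (2 * pi) * cnj (f t)" for t
  proof -
    have "(LINT \<xi>|lborel. cnj (g \<xi>) * exp (- \<i> * complex_of_real (t * \<xi>))) = (LINT \<xi>|lborel. cnj (g \<xi> * exp (\<i> * complex_of_real (t * \<xi>))))"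
      by (simp add: exp_cnj)
    also have "\<dots> = cnj (sqrt (2 * pi) * f t)"
      unfolding Bochner_Integration.integral_cnj L2_fourier_inversion[OF f bdd fg g] ..
    finally show ?thesis by simp
  qed
  have "(\<lambda>N. LINT \<xi>|lborel. fourier_trunc (real N) f \<xi> * cnj (g \<xi>)) \<longlonglongrightarrow> (LINT \<xi>|lborel. g \<xi> * cnj (g \<xi>))"
    by (rule tendsto_integral_fourier_trunc[OF f fg cg1 cg2])
  moreover have "(\<lambda>N. LINT \<xi>|lborel. fourier_trunc (real N) f \<xi> * cnj (g \<xi>))
      \<longlonglongrightarrow> complex_of_real (1 / sqrt (2 * pi)) * (LINT t|lborel. f t * (sqrt (2 * pi) * cnj (f t)))"
    unfolding fourier_trunc_multiplication(2)[OF f cg1] ft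
    by (intro tendsto_mult tendsto_const set_integral_truncation_tendsto square_integrable_imp_integrable_mult sq(1) cf)
  ultimately have "(LINT \<xi>|lborel. g \<xi> * cnj (g \<xi>)) = complex_of_real (1 / sqrt (2 * pi)) * (LINT t|lborel. f t * (sqrt (2 * pi) * cnj (f t)))"
    by (rule LIMSEQ_unique)
  also have "\<dots> = (LINT t|lborel. f t * cnj (f t))"
  proof -
    have "(LINT t|lborel. f t * (complex_of_real (sqrt (2 * pi)) * cnj (f t)))
        = (LINT t|lborel. complex_of_real (sqrt (2 * pi)) * (f t * cnj (f t)))"
      by (simp only: mult.left_commute)
    also have "\<dots> = complex_of_real (sqrt (2 * pi)) * (LINT t|lborel. f t * cnj (f t))"
      by (rule integral_mult_right_zero)
    finally have "(LINT t|lborel. f t * (complex_of_real (sqrt (2 * pi)) * cnj (f t)))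
        = complex_of_real (sqrt (2 * pi)) * (LINT t|lborel. f t * cnj (f t))" .
    moreover have "complex_of_real (1 / sqrt (2 * pi)) * complex_of_real (sqrt (2 * pi)) = 1"
      by (simp flip: of_real_mult)
    ultimately show ?thesis by (simp only: mult.assoc[symmetric] mult_1_left)
  qed
  finally have "(LINT \<xi>|lborel. complex_of_real ((cmod (g \<xi>))\<^sup>2)) = (LINT t|lborel. complex_of_real ((cmod (f t))\<^sup>2))"
    by (simp add: complex_norm_square[symmetric] del: of_real_power)
  then show ?thesis by (simp only: integral_complex_of_real of_real_eq_iff L2_norm_def)
qed

section \<open>Trigonometric sums against a band-limited spectrum\<close>

lemma integral_exp_int:
  fixes n :: int
  shows "(LINT \<xi>|lborel. indicator {-pi..pi} \<xi> *\<^sub>R exp (\<i> * of_real \<xi> * of_int n)) = (if n = 0 then 2 * of_real pi else 0)"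
proof (cases "n = 0")
  case True
  have "(LINT \<xi>|lborel. indicator {-pi..pi} \<xi> *\<^sub>R (1::complex)) = of_real pi - of_real (- pi)"
    by (rule integral_FTC_atLeastAtMost)
       (auto intro!: derivative_eq_intros simp: has_vector_derivative_of_real)
  then show ?thesis using True by simp
next
  case False
  have "(LINT \<xi>|lborel. indicator {-pi..pi} \<xi> *\<^sub>R exp (\<i> * of_real \<xi> * of_int n))
      = exp (\<i> * of_real pi * of_int n) / (\<i> * of_int n) - exp (\<i> * of_real (- pi) * of_int n) / (\<i> * of_int n)"
  proof (rule integral_FTC_atLeastAtMost)
    fix x :: real
    have "((\<lambda>z. exp (\<i> * z * of_int n) / (\<i> * of_int n)) has_field_derivative exp (\<i> * of_real x * of_int n)) (at (of_real x))"
      using False by (auto intro!: derivative_eq_intros simp: field_simps)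
    from has_vector_derivative_real_field[OF this]
    show "((\<lambda>x. exp (\<i> * of_real x * of_int n) / (\<i> * of_int n)) has_vector_derivative exp (\<i> * of_real x * of_int n)) (at x within {- pi..pi})"
      by (simp add: o_def)
  qed (auto intro!: continuous_intros)
  also have "exp (\<i> * of_real pi * of_int n) = exp (\<i> * of_real (- pi) * of_int n)"
    unfolding exp_eq by (rule exI[of _ n]) (simp add: algebra_simps)
  finally show ?thesis using False by simp
qed

lemma trigonometric_parseval:
  fixes c :: "int \<Rightarrow> complex"
  assumes "finite A"
  shows "square_integrable lborel (\<lambda>\<xi>. indicator {-pi..pi} \<xi> *\<^sub>R (\<Sum>j\<in>A. c j * exp (\<i> * of_real \<xi> * of_int j)))"
    and "L2_norm lborel (\<lambda>\<xi>. indicator {-pi..pi} \<xi> *\<^sub>R (\<Sum>j\<in>A. c j * exp (\<i> * of_real \<xi> * of_int j)))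
       = sqrt (2 * pi * (\<Sum>j\<in>A. (cmod (c j))\<^sup>2))"
proof -
  define p where "p \<xi> = (\<Sum>j\<in>A. c j * exp (\<i> * of_real \<xi> * of_int j))" for \<xi> :: real
  have E_int: "integrable lborel (\<lambda>\<xi>. indicator {-pi..pi} \<xi> *\<^sub>R exp (\<i> * of_real \<xi> * of_int n))" for n :: int
    by (rule borel_integrable_atLeastAtMost'[unfolded set_integrable_def]) (intro continuous_intros)
  have sq: "complex_of_real ((cmod (indicator {-pi..pi} \<xi> *\<^sub>R p \<xi>))\<^sup>2)
      = (\<Sum>j\<in>A. \<Sum>k\<in>A. (c j * cnj (c k)) * (indicator {-pi..pi} \<xi> *\<^sub>R exp (\<i> * of_real \<xi> * of_int (j - k))))" for \<xi>
  proof -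
    have "complex_of_real ((cmod (indicator {-pi..pi} \<xi> *\<^sub>R p \<xi>))\<^sup>2) = indicator {-pi..pi} \<xi> *\<^sub>R (p \<xi> * cnj (p \<xi>))"
      by (simp add: indicator_def complex_norm_square[symmetric])
    also have "p \<xi> * cnj (p \<xi>) = (\<Sum>j\<in>A. \<Sum>k\<in>A. (c j * exp (\<i> * of_real \<xi> * of_int j)) * cnj (c k * exp (\<i> * of_real \<xi> * of_int k)))"
      by (simp only: p_def cnj_sum sum_product)
    also have "\<dots> = (\<Sum>j\<in>A. \<Sum>k\<in>A. (c j * cnj (c k)) * exp (\<i> * of_real \<xi> * of_int (j - k)))"
    proof (intro sum.cong refl)
      fix j k
      have "exp (\<i> * of_real \<xi> * of_int (j - k)) = exp (\<i> * of_real \<xi> * of_int j) * exp (- (\<i> * of_real \<xi> * of_int k))"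
        by (simp add: right_diff_distrib exp_diff exp_minus divide_inverse)
      then show "(c j * exp (\<i> * of_real \<xi> * of_int j)) * cnj (c k * exp (\<i> * of_real \<xi> * of_int k))
         = (c j * cnj (c k)) * exp (\<i> * of_real \<xi> * of_int (j - k))"
        by (simp add: exp_cnj)
    qed
    finally show ?thesis by (simp add: scaleR_sum_right mult_scaleR_right)
  qed
  have int: "integrable lborel (\<lambda>\<xi>. complex_of_real ((cmod (indicator {-pi..pi} \<xi> *\<^sub>R p \<xi>))\<^sup>2))"
    unfolding sq by (intro Bochner_Integration.integrable_sum integrable_mult_right E_int)
  have [measurable]: "p \<in> borel_measurable borel"
    unfolding p_def by (intro borel_measurable_continuous_onI continuous_intros)
  have "integrable lborel (\<lambda>\<xi>. (cmod (indicator {-pi..pi} \<xi> *\<^sub>R p \<xi>))\<^sup>2)"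
    using int by (simp only: complex_of_real_integrable_eq)
  then show "square_integrable lborel (\<lambda>\<xi>. indicator {-pi..pi} \<xi> *\<^sub>R (\<Sum>j\<in>A. c j * exp (\<i> * of_real \<xi> * of_int j)))"
    unfolding square_integrable_def p_def[symmetric] by simp
  have "complex_of_real (LINT \<xi>|lborel. (cmod (indicator {-pi..pi} \<xi> *\<^sub>R p \<xi>))\<^sup>2)
      = (LINT \<xi>|lborel. complex_of_real ((cmod (indicator {-pi..pi} \<xi> *\<^sub>R p \<xi>))\<^sup>2))"
    by (rule integral_complex_of_real[symmetric])
  also have "\<dots> = (\<Sum>j\<in>A. \<Sum>k\<in>A. (c j * cnj (c k)) * (if j - k = 0 then 2 * of_real pi else 0))"
    unfolding sq
    by (subst Bochner_Integration.integral_sum, intro Bochner_Integration.integrable_sum integrable_mult_right E_int,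
        intro sum.cong refl, subst Bochner_Integration.integral_sum, intro integrable_mult_right E_int,
        intro sum.cong refl) (simp only: integral_mult_right_zero integral_exp_int)
  also have "\<dots> = (\<Sum>j\<in>A. \<Sum>k\<in>A. if k = j then c j * cnj (c j) * (2 * of_real pi) else 0)"
    by (intro sum.cong refl) auto
  also have "\<dots> = complex_of_real (2 * pi * (\<Sum>j\<in>A. (cmod (c j))\<^sup>2))"
    using assms by (simp add: complex_norm_square[symmetric] sum_distrib_left mult_ac del: of_real_power)
  finally have "(LINT \<xi>|lborel. (cmod (indicator {-pi..pi} \<xi> *\<^sub>R p \<xi>))\<^sup>2) = 2 * pi * (\<Sum>j\<in>A. (cmod (c j))\<^sup>2)"
    by (simp only: of_real_eq_iff)
  then show "L2_norm lborel (\<lambda>\<xi>. indicator {-pi..pi} \<xi> *\<^sub>R (\<Sum>j\<in>A. c j * exp (\<i> * of_real \<xi> * of_int j)))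
       = sqrt (2 * pi * (\<Sum>j\<in>A. (cmod (c j))\<^sup>2))"
    by (simp add: L2_norm_def p_def)
qed

lemma square_integrable_bounded_support_integrable:
  fixes g :: "real \<Rightarrow> complex"
  assumes g: "square_integrable lborel g" and supp: "AE \<xi> in lborel. \<xi> \<notin> {-\<delta>..\<delta>} \<longrightarrow> g \<xi> = 0"
  shows "integrable lborel g"
proof -
  have [measurable]: "g \<in> borel_measurable borel" using g by (simp add: square_integrable_def)
  have "square_integrable lborel (\<lambda>\<xi>. indicator {-\<delta>..\<delta>} \<xi> :: complex)"
  proof -
    have "(\<lambda>\<xi>. (cmod (indicator {-\<delta>..\<delta>} \<xi>))\<^sup>2) = (\<lambda>\<xi>. indicator {-\<delta>..\<delta>} \<xi> :: real)"
      by (auto simp: indicator_def)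
    moreover have "integrable lborel (indicator {-\<delta>..\<delta>} :: real \<Rightarrow> real)"
      by (rule integrable_real_indicator) (auto simp: emeasure_lborel_Icc_eq)
    moreover have "(indicator {-\<delta>..\<delta>} :: real \<Rightarrow> complex) \<in> borel_measurable lborel"
      by (rule borel_measurable_indicator) simp
    ultimately show ?thesis by (simp add: square_integrable_def)
  qed
  from square_integrable_imp_integrable_mult[OF g this]
  show ?thesis
    by (rule integrable_cong_AE_imp) (use supp in \<open>auto simp: indicator_def elim!: eventually_mono\<close>)
qed

text \<open>If \<open>e\<close> is the sum of the trigonometric series with coefficients \<open>c\<close> on the band, then what
remains of it after removing the terms in \<open>K\<close> is the tail of the series. One factor of its squared modulus
is bounded by \<open>S1\<close> pointwise. The other one is bounded in \<open>L\<^sup>2\<close> of a full period, where the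
exponentials are orthogonal. The partial sums of the tail are uniformly bounded by \<open>S1\<close>, so dominated
convergence transfers the bound to the limit.\<close>
lemma weighted_tail_bound:
  fixes g :: "real \<Rightarrow> complex" and c :: "int \<Rightarrow> complex" and e :: "real \<Rightarrow> complex"
  assumes g: "square_integrable lborel g" "L2_norm lborel g \<le> 1"
    and supp: "AE \<xi> in lborel. \<xi> \<notin> {-\<delta>..\<delta>} \<longrightarrow> g \<xi> = 0" and \<delta>: "\<delta> \<le> pi"
    and series: "\<And>\<xi>. \<bar>\<xi>\<bar> \<le> \<delta> \<Longrightarrow> (\<lambda>N. \<Sum>j\<in>{- int N..int N}. c j * exp (\<i> * of_real \<xi> * of_int j)) \<longlonglongrightarrow> e \<xi>"
    and K: "K \<subseteq> {- int N0..int N0}" and e: "e \<in> borel_measurable borel"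
    and l1: "\<And>N. (\<Sum>j\<in>{- int N..int N} - K. cmod (c j)) \<le> S1"
    and l2: "\<And>N. (\<Sum>j\<in>{- int N..int N} - K. (cmod (c j))\<^sup>2) \<le> S2"
  shows "cmod (LINT \<xi>|lborel. g \<xi> * of_real ((cmod (e \<xi> - (\<Sum>j\<in>K. c j * exp (\<i> * of_real \<xi> * of_int j))))\<^sup>2))
     \<le> sqrt (2 * pi) * (S1 * sqrt S2)"
proof -
  define E where "E j \<xi> = exp (\<i> * of_real \<xi> * of_int j)" for j :: int and \<xi> :: real
  define r where "r \<xi> = e \<xi> - (\<Sum>j\<in>K. c j * E j \<xi>)" for \<xi>
  define A where "A N = {- int N..int N} - K" for N
  define p where "p N \<xi> = (\<Sum>j\<in>A N. c j * E j \<xi>)" for N \<xi>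
  have nE: "cmod (E j \<xi>) = 1" for j \<xi>
    by (simp add: E_def mult.assoc norm_exp_i_times[of "\<xi> * of_int j", simplified])
  have [measurable]: "E j \<in> borel_measurable borel" for j
    unfolding E_def by (intro borel_measurable_continuous_onI continuous_intros)
  have [measurable]: "p N \<in> borel_measurable borel" for N
    unfolding p_def by measurable
  have [measurable]: "r \<in> borel_measurable borel"
    unfolding r_def using e by measurable
  have [measurable]: "g \<in> borel_measurable borel" using g by (simp add: square_integrable_def)
  have g_int: "integrable lborel g"
    by (rule square_integrable_bounded_support_integrable[OF g(1) supp])
  have S1: "0 \<le> S1" using order_trans[OF sum_nonneg l1] by simp
  have p_le: "cmod (p N \<xi>) \<le> S1" for N \<xi>
  proof -
    have "cmod (p N \<xi>) \<le> (\<Sum>j\<in>A N. cmod (c j))"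
      unfolding p_def by (rule order_trans[OF norm_sum]) (simp add: norm_mult nE)
    also have "\<dots> \<le> S1" unfolding A_def by (rule l1)
    finally show ?thesis .
  qed
  have p_lim: "(\<lambda>N. p N \<xi>) \<longlonglongrightarrow> r \<xi>" if "\<bar>\<xi>\<bar> \<le> \<delta>" for \<xi>
  proof -
    have "(\<lambda>N. (\<Sum>j\<in>{- int N..int N}. c j * E j \<xi>) - (\<Sum>j\<in>K. c j * E j \<xi>)) \<longlonglongrightarrow> r \<xi>"
      unfolding r_def E_def by (intro tendsto_intros series that)
    moreover have "\<forall>\<^sub>F N in sequentially. (\<Sum>j\<in>{- int N..int N}. c j * E j \<xi>) - (\<Sum>j\<in>K. c j * E j \<xi>) = p N \<xi>"
    proof (rule eventually_sequentiallyI[of N0])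
      fix N assume "N0 \<le> N"
      then have "K \<subseteq> {- int N..int N}" using K by force
      then show "(\<Sum>j\<in>{- int N..int N}. c j * E j \<xi>) - (\<Sum>j\<in>K. c j * E j \<xi>) = p N \<xi>"
        unfolding p_def A_def by (simp add: sum_diff)
    qed
    ultimately show ?thesis by (rule Lim_transform_eventually)
  qed
  have bound: "cmod (LINT \<xi>|lborel. g \<xi> * of_real ((cmod (p N \<xi>))\<^sup>2)) \<le> sqrt (2 * pi) * (S1 * sqrt S2)" for N
  proof -
    let ?q = "\<lambda>\<xi>. indicator {-pi..pi} \<xi> *\<^sub>R p N \<xi>"
    have q: "square_integrable lborel ?q" "L2_norm lborel ?q = sqrt (2 * pi * (\<Sum>j\<in>A N. (cmod (c j))\<^sup>2))"
      unfolding p_def E_def by (intro trigonometric_parseval; simp add: A_def)+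
    have gq: "integrable lborel (\<lambda>\<xi>. cmod (g \<xi>) * cmod (?q \<xi>))"
      using integrable_norm[OF square_integrable_imp_integrable_mult[OF g(1) q(1)]] by (simp only: norm_mult)
    have "cmod (LINT \<xi>|lborel. g \<xi> * of_real ((cmod (p N \<xi>))\<^sup>2)) \<le> (LINT \<xi>|lborel. S1 * (cmod (g \<xi>) * cmod (?q \<xi>)))"
    proof (rule order_trans[OF integral_norm_bound], rule integral_mono_AE)
      show "integrable lborel (\<lambda>\<xi>. norm (g \<xi> * of_real ((cmod (p N \<xi>))\<^sup>2)))"
      proof (rule integrable_norm, rule Bochner_Integration.integrable_bound)
        show "integrable lborel (\<lambda>\<xi>. S1\<^sup>2 *\<^sub>R g \<xi>)" using g_int by simp
        show "AE \<xi> in lborel. norm (g \<xi> * of_real ((cmod (p N \<xi>))\<^sup>2)) \<le> norm (S1\<^sup>2 *\<^sub>R g \<xi>)"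
        proof (intro AE_I2)
          fix \<xi>
          have "(cmod (p N \<xi>))\<^sup>2 \<le> S1\<^sup>2" using p_le by (intro power_mono) auto
          then have "cmod (g \<xi>) * (cmod (p N \<xi>))\<^sup>2 \<le> cmod (g \<xi>) * S1\<^sup>2" by (intro mult_left_mono) auto
          then show "norm (g \<xi> * of_real ((cmod (p N \<xi>))\<^sup>2)) \<le> norm (S1\<^sup>2 *\<^sub>R g \<xi>)"
            by (simp add: norm_mult norm_power mult.commute)
        qed
      qed measurable
      show "integrable lborel (\<lambda>\<xi>. S1 * (cmod (g \<xi>) * cmod (?q \<xi>)))" using gq by simp
      show "AE \<xi> in lborel. norm (g \<xi> * of_real ((cmod (p N \<xi>))\<^sup>2)) \<le> S1 * (cmod (g \<xi>) * cmod (?q \<xi>))"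
        using supp
      proof (rule eventually_mono)
        fix \<xi> assume s: "\<xi> \<notin> {-\<delta>..\<delta>} \<longrightarrow> g \<xi> = 0"
        show "norm (g \<xi> * of_real ((cmod (p N \<xi>))\<^sup>2)) \<le> S1 * (cmod (g \<xi>) * cmod (?q \<xi>))"
        proof (cases "\<xi> \<in> {-\<delta>..\<delta>}")
          case True
          then have "\<xi> \<in> {-pi..pi}" using \<delta> by auto
          moreover have "cmod (p N \<xi>) * (cmod (g \<xi>) * cmod (p N \<xi>)) \<le> S1 * (cmod (g \<xi>) * cmod (p N \<xi>))"
            by (intro mult_right_mono p_le) auto
          ultimately show ?thesis by (simp add: norm_mult norm_power power2_eq_square mult_ac)
        qed (use s S1 in simp)
      qed
    qed
    also have "\<dots> = S1 * (LINT \<xi>|lborel. cmod (g \<xi>) * cmod (?q \<xi>))" by (rule integral_mult_right_zero)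
    also have "\<dots> \<le> S1 * (L2_norm lborel g * L2_norm lborel ?q)"
      by (intro mult_left_mono L2_Cauchy_Schwarz g q S1)
    also have "\<dots> \<le> S1 * (1 * sqrt (2 * pi * S2))"
    proof (intro mult_left_mono mult_mono S1 g(2))
      show "L2_norm lborel ?q \<le> sqrt (2 * pi * S2)"
        unfolding q(2) A_def using l2[of N] by simp
    qed (auto simp: L2_norm_def)
    also have "\<dots> = sqrt (2 * pi) * (S1 * sqrt S2)" by (simp add: real_sqrt_mult)
    finally show ?thesis .
  qed
  have "(\<lambda>N. LINT \<xi>|lborel. g \<xi> * of_real ((cmod (p N \<xi>))\<^sup>2)) \<longlonglongrightarrow> (LINT \<xi>|lborel. g \<xi> * of_real ((cmod (r \<xi>))\<^sup>2))"
  proof (rule integral_dominated_convergence[where w = "\<lambda>\<xi>. S1\<^sup>2 * cmod (g \<xi>)"])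
    show "AE \<xi> in lborel. (\<lambda>N. g \<xi> * of_real ((cmod (p N \<xi>))\<^sup>2)) \<longlonglongrightarrow> g \<xi> * of_real ((cmod (r \<xi>))\<^sup>2)"
      using supp
    proof (rule eventually_mono)
      fix \<xi> assume s: "\<xi> \<notin> {-\<delta>..\<delta>} \<longrightarrow> g \<xi> = 0"
      show "(\<lambda>N. g \<xi> * of_real ((cmod (p N \<xi>))\<^sup>2)) \<longlonglongrightarrow> g \<xi> * of_real ((cmod (r \<xi>))\<^sup>2)"
      proof (cases "\<xi> \<in> {-\<delta>..\<delta>}")
        case True
        then show ?thesis by (intro tendsto_intros p_lim) auto
      qed (use s in simp)
    qed
    show "AE \<xi> in lborel. norm (g \<xi> * of_real ((cmod (p N \<xi>))\<^sup>2)) \<le> S1\<^sup>2 * cmod (g \<xi>)" for N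
    proof (intro AE_I2)
      fix \<xi>
      have "(cmod (p N \<xi>))\<^sup>2 \<le> S1\<^sup>2" using p_le by (intro power_mono) auto
      then have "(cmod (p N \<xi>))\<^sup>2 * cmod (g \<xi>) \<le> S1\<^sup>2 * cmod (g \<xi>)" by (intro mult_right_mono) auto
      then show "norm (g \<xi> * of_real ((cmod (p N \<xi>))\<^sup>2)) \<le> S1\<^sup>2 * cmod (g \<xi>)"
        by (simp add: norm_mult norm_power mult.commute)
    qed
    show "integrable lborel (\<lambda>\<xi>. S1\<^sup>2 * cmod (g \<xi>))" using g_int by simp
  qed measurable
  then have "(\<lambda>N. cmod (LINT \<xi>|lborel. g \<xi> * of_real ((cmod (p N \<xi>))\<^sup>2))) \<longlonglongrightarrow> cmod (LINT \<xi>|lborel. g \<xi> * of_real ((cmod (r \<xi>))\<^sup>2))"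
    by (rule tendsto_norm)
  then have "cmod (LINT \<xi>|lborel. g \<xi> * of_real ((cmod (r \<xi>))\<^sup>2)) \<le> sqrt (2 * pi) * (S1 * sqrt S2)"
    by (rule LIMSEQ_le_const2) (use bound in blast)
  then show ?thesis by (simp only: r_def E_def)
qed


section \<open>Second-order structure of stationary processes\<close>

lemma wss_autocorr:
  assumes "wss M X"
  shows "(LINT \<omega>|M. X s \<omega> * cnj (X u \<omega>)) = autocorr M X (s - u)"
proof -
  obtain R where R: "\<And>t \<tau>. autocorr2 M X t \<tau> = R (t - \<tau>)" using assms by (auto simp: wss_def)
  show ?thesis by (simp add: autocorr_def R flip: autocorr2_def)
qed

lemma wss_square_integrable: "wss M X \<Longrightarrow> square_integrable M (X t)"
  by (simp add: wss_def)

lemma square_integrable_cnj: "square_integrable M f \<Longrightarrow> square_integrable M (\<lambda>x. cnj (f x))"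
  by (auto simp: square_integrable_def intro: borel_measurable_continuous_on[of cnj, OF continuous_on_cnj[OF continuous_on_id]])

text \<open>By stationarity all \<open>X s\<close> have the same second moment, so this is Cauchy--Schwarz in
\<open>L\<^sup>2(\<Omega>)\<close>.\<close>
lemma wss_autocorr_bounded:
  assumes X: "wss M X"
  shows "cmod (autocorr M X t) \<le> (L2_norm M (X 0))\<^sup>2"
proof -
  have norm_eq: "L2_norm M (X s) = L2_norm M (X 0)" for s
  proof -
    have "complex_of_real (LINT \<omega>|M. (cmod (X s \<omega>))\<^sup>2) = autocorr M X 0" for s
      using wss_autocorr[OF X, of s s]
      by (simp add: complex_norm_square[symmetric] del: of_real_power)
    then have "complex_of_real (LINT \<omega>|M. (cmod (X s \<omega>))\<^sup>2) = complex_of_real (LINT \<omega>|M. (cmod (X 0 \<omega>))\<^sup>2)" by simp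
    then show ?thesis by (simp only: of_real_eq_iff L2_norm_def)
  qed
  have sq: "square_integrable M (X s)" for s using X by (rule wss_square_integrable)
  have "cmod (autocorr M X t) \<le> (LINT \<omega>|M. cmod (X t \<omega> * cnj (X 0 \<omega>)))"
    unfolding autocorr_def autocorr2_def by (rule integral_norm_bound)
  also have "\<dots> = (LINT \<omega>|M. cmod (X t \<omega>) * cmod (X 0 \<omega>))" by (simp add: norm_mult)
  also have "\<dots> \<le> L2_norm M (X t) * L2_norm M (X 0)" by (intro L2_Cauchy_Schwarz sq)
  also have "\<dots> = (L2_norm M (X 0))\<^sup>2" unfolding norm_eq[of t] by (simp add: power2_eq_square)
  finally show ?thesis .
qed

text \<open>Both sides are the same quadratic form in the coefficients: sesquilinear expansion reduces the
claim to the representation of each covariance as an integral against \<open>g\<close>.\<close>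
lemma wss_spectral_isometry:
  fixes b :: "'i \<Rightarrow> complex" and s :: "'i \<Rightarrow> real"
  assumes X: "wss M X" and g: "integrable lborel g"
    and inv: "\<And>u. (LINT \<xi>|lborel. g \<xi> * exp (\<i> * complex_of_real (u * \<xi>))) = sqrt (2 * pi) * autocorr M X u"
  shows "sqrt (2 * pi) * complex_of_real (LINT \<omega>|M. (cmod (\<Sum>i\<in>I. b i * X (s i) \<omega>))\<^sup>2)
     = (LINT \<xi>|lborel. g \<xi> * of_real ((cmod (\<Sum>i\<in>I. b i * exp (\<i> * of_real (s i * \<xi>))))\<^sup>2))"
proof -
  have [measurable]: "g \<in> borel_measurable borel" using g by auto
  have X_int: "integrable M (\<lambda>\<omega>. X u \<omega> * cnj (X v \<omega>))" for u v
    by (intro square_integrable_imp_integrable_mult square_integrable_cnj wss_square_integrable[OF X])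
  have g_int: "integrable lborel (\<lambda>\<xi>. g \<xi> * exp (\<i> * complex_of_real (u * \<xi>)))" for u
    by (rule Bochner_Integration.integrable_bound[OF g]) (auto simp: norm_mult)
  have sq: "of_real ((cmod (\<Sum>i\<in>I. b i * z i))\<^sup>2) = (\<Sum>i\<in>I. \<Sum>k\<in>I. (b i * cnj (b k)) * (z i * cnj (z k)))" for z :: "'i \<Rightarrow> complex"
    unfolding complex_norm_square cnj_sum sum_product by (simp add: mult_ac)
  have "complex_of_real (LINT \<omega>|M. (cmod (\<Sum>i\<in>I. b i * X (s i) \<omega>))\<^sup>2)
     = (LINT \<omega>|M. complex_of_real ((cmod (\<Sum>i\<in>I. b i * X (s i) \<omega>))\<^sup>2))"
    by (rule integral_complex_of_real[symmetric])
  also have "\<dots> = (LINT \<omega>|M. (\<Sum>i\<in>I. \<Sum>k\<in>I. (b i * cnj (b k)) * (X (s i) \<omega> * cnj (X (s k) \<omega>))))"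
    by (simp only: sq)
  also have "\<dots> = (\<Sum>i\<in>I. \<Sum>k\<in>I. (b i * cnj (b k)) * autocorr M X (s i - s k))"
    by (subst Bochner_Integration.integral_sum, intro Bochner_Integration.integrable_sum integrable_mult_right X_int,
        intro sum.cong refl, subst Bochner_Integration.integral_sum, intro integrable_mult_right X_int,
        intro sum.cong refl) (simp only: integral_mult_right_zero wss_autocorr[OF X])
  finally have lhs: "complex_of_real (LINT \<omega>|M. (cmod (\<Sum>i\<in>I. b i * X (s i) \<omega>))\<^sup>2)
     = (\<Sum>i\<in>I. \<Sum>k\<in>I. (b i * cnj (b k)) * autocorr M X (s i - s k))" .
  have "exp (\<i> * of_real (s i * \<xi>)) * cnj (exp (\<i> * of_real (s k * \<xi>))) = exp (\<i> * complex_of_real ((s i - s k) * \<xi>))" for i k \<xi>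
    by (simp add: exp_cnj left_diff_distrib right_diff_distrib exp_diff exp_minus divide_inverse)
  then have "(LINT \<xi>|lborel. g \<xi> * of_real ((cmod (\<Sum>i\<in>I. b i * exp (\<i> * of_real (s i * \<xi>))))\<^sup>2))
     = (LINT \<xi>|lborel. (\<Sum>i\<in>I. \<Sum>k\<in>I. (b i * cnj (b k)) * (g \<xi> * exp (\<i> * complex_of_real ((s i - s k) * \<xi>)))))"
    by (simp only: sq sum_distrib_left mult.left_commute)
  also have "\<dots> = (\<Sum>i\<in>I. \<Sum>k\<in>I. (b i * cnj (b k)) * (sqrt (2 * pi) * autocorr M X (s i - s k)))"
    by (subst Bochner_Integration.integral_sum, intro Bochner_Integration.integrable_sum integrable_mult_right g_int,
        intro sum.cong refl, subst Bochner_Integration.integral_sum, intro integrable_mult_right g_int,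
        intro sum.cong refl) (simp only: integral_mult_right_zero inv)
  finally show ?thesis unfolding lhs by (simp only: sum_distrib_left mult.left_commute)
qed

section \<open>Explicit tail estimates\<close>

text \<open>The inductive step is \<open>e \<le> (1 + 1/m)\<^sup>m\<^sup>+\<^sup>1\<^sup>/\<^sup>2\<close>, that is, the lower bound
\<open>2 / (2 m + 1)\<close> for \<open>ln (m + 1) - ln m\<close>.\<close>
lemma fact_le_stirling:
  assumes "m \<ge> 1"
  shows "fact m \<le> exp 1 * sqrt (real m) * (real m / exp 1) ^ m"
  using assms
proof (induction m rule: dec_induct)
  case (step m)
  have m: "real m > 0" using step by simp
  have "2 * (real (Suc m) - real m) / (real m + real (Suc m)) \<le> ln (real (Suc m)) - ln (real m)"
    using m by (intro ln_inverse_approx_ge) auto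
  then have "(real m + 1 / 2) * (2 / (2 * real m + 1)) \<le> (real m + 1 / 2) * (ln (real (Suc m)) - ln (real m))"
    by (intro mult_left_mono) (auto simp: add_ac)
  moreover have "(real m + 1 / 2) * (2 / (2 * real m + 1)) = 1"
    using m by (simp add: field_simps)
  ultimately have "1 + (real m + 1 / 2) * ln (real m) \<le> (real m + 1 / 2) * ln (real (Suc m))"
    by (simp add: algebra_simps)
  then have "exp (1 + (real m + 1 / 2) * ln (real m)) \<le> exp ((real m + 1 / 2) * ln (real (Suc m)))"
    by simp
  then have "exp 1 * real m powr (real m + 1 / 2) \<le> real (Suc m) powr (real m + 1 / 2)"
    using m by (simp add: powr_def exp_add)
  then have key: "exp 1 * (sqrt (real m) * real m ^ m) \<le> sqrt (real (Suc m)) * real (Suc m) ^ m"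
    using m by (simp add: powr_add powr_realpow powr_half_sqrt mult_ac)
  have "fact (Suc m) = real (Suc m) * fact m" by simp
  also have "\<dots> \<le> real (Suc m) * (exp 1 * sqrt (real m) * (real m / exp 1) ^ m)"
    using step.IH by (intro mult_left_mono) auto
  also have "\<dots> = real (Suc m) * (exp 1 * (sqrt (real m) * real m ^ m)) / exp 1 ^ m"
    by (simp add: power_divide)
  also have "\<dots> \<le> real (Suc m) * (sqrt (real (Suc m)) * real (Suc m) ^ m) / exp 1 ^ m"
    using key by (intro divide_right_mono mult_left_mono) auto
  also have "\<dots> = exp 1 * sqrt (real (Suc m)) * (real (Suc m) / exp 1) ^ Suc m"
    by (simp add: power_divide)
  finally show ?case .
qed simp

text \<open>The integral comparison, in a telescoping form that is proved by induction on \<open>N\<close>; the step is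
Bernoulli's inequality.\<close>
lemma sum_inverse_power_tail_le:
  fixes n N p :: nat
  assumes "n \<ge> 1" "p \<ge> 1" "n \<le> N"
  shows "(\<Sum>i\<in>{n..N}. 1 / real i ^ Suc p)
       \<le> 1 / real n ^ Suc p + 1 / (real p * real n ^ p) - 1 / (real p * real N ^ p)"
  using assms(3)
proof (induction N rule: dec_induct)
  case (step N)
  have N: "real N > 0" using step assms by simp
  have "1 + real p * (1 / real N) \<le> (1 + 1 / real N) ^ p"
    by (rule Bernoulli_inequality) (use N in \<open>simp add: order_trans[of _ 0]\<close>)
  also have "1 + 1 / real N = real (Suc N) / real N" using N by (simp add: field_simps)
  finally have "1 + real p / real N \<le> real (Suc N) ^ p / real N ^ p" by (simp add: power_divide)
  then have "(1 + real p / real N) / real (Suc N) ^ p \<le> real (Suc N) ^ p / real N ^ p / real (Suc N) ^ p"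
    by (intro divide_right_mono) auto
  then have "1 / real (Suc N) ^ p + real p / (real N * real (Suc N) ^ p) \<le> 1 / real N ^ p"
    using N by (simp add: add_divide_distrib)
  moreover have "real p / (real (Suc N) * real (Suc N) ^ p) \<le> real p / (real N * real (Suc N) ^ p)"
    using N by (intro divide_left_mono mult_right_mono mult_pos_pos) auto
  ultimately have "1 / real (Suc N) ^ p + real p / real (Suc N) ^ Suc p \<le> 1 / real N ^ p" by simp
  then have "(1 / real (Suc N) ^ p + real p / real (Suc N) ^ Suc p) / real p \<le> 1 / real N ^ p / real p"
    by (intro divide_right_mono) auto
  then have "1 / real (Suc N) ^ Suc p \<le> 1 / (real p * real N ^ p) - 1 / (real p * real (Suc N) ^ p)"
    using assms(2) by (simp add: add_divide_distrib mult.commute)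
  then show ?case using step by simp
qed simp

text \<open>Since \<open>0 < t < 1\<close>, the point \<open>-i\<close> and the point \<open>i + 1\<close> both have distance at least \<open>i\<close> from
\<open>t\<close>, and the integers outside \<open>J n\<close> are of these two kinds with \<open>i \<ge> n\<close>.\<close>
lemma sum_distance_power_tail_le:
  fixes t :: real and n N p :: nat
  assumes "n \<ge> 1" "p \<ge> 1" and t: "0 < t" "t < 1"
  shows "(\<Sum>j\<in>{- int N..int N} - J n. 1 / \<bar>t - of_int j\<bar> ^ Suc p)
       \<le> 2 * (1 / real n ^ Suc p + 1 / (real p * real n ^ p))"
proof -
  let ?f = "\<lambda>j::int. 1 / \<bar>t - of_int j\<bar> ^ Suc p"
  have half: "(\<Sum>i\<in>{n..M}. 1 / real i ^ Suc p) \<le> 1 / real n ^ Suc p + 1 / (real p * real n ^ p)" for M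
  proof (cases "n \<le> M")
    case True
    have "0 \<le> 1 / (real p * real M ^ p)" by simp
    then show ?thesis using sum_inverse_power_tail_le[OF assms(1,2) True] by linarith
  qed simp
  have "(\<Sum>j\<in>{- int N..- int n}. ?f j) = (\<Sum>i\<in>{n..N}. ?f (- int i))"
    by (rule sum.reindex_bij_witness[of _ "\<lambda>i. - int i" "\<lambda>j. nat (- j)"]) (auto simp: nat_le_iff le_nat_iff)
  also have "\<dots> \<le> (\<Sum>i\<in>{n..N}. 1 / real i ^ Suc p)"
    using t assms(1) by (intro sum_mono divide_left_mono power_mono mult_pos_pos zero_less_power) auto
  finally have left: "(\<Sum>j\<in>{- int N..- int n}. ?f j) \<le> 1 / real n ^ Suc p + 1 / (real p * real n ^ p)"
    using half[of N] by linarith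
  have "(\<Sum>j\<in>{int n + 1..int N + 1}. ?f j) = (\<Sum>i\<in>{n..N}. ?f (int i + 1))"
    by (rule sum.reindex_bij_witness[of _ "\<lambda>i. int i + 1" "\<lambda>j. nat (j - 1)"]) (auto simp: nat_le_iff le_nat_iff)
  also have "\<dots> \<le> (\<Sum>i\<in>{n..N}. 1 / real i ^ Suc p)"
    using t assms(1) by (intro sum_mono divide_left_mono power_mono mult_pos_pos zero_less_power) auto
  finally have right: "(\<Sum>j\<in>{int n + 1..int N + 1}. ?f j) \<le> 1 / real n ^ Suc p + 1 / (real p * real n ^ p)"
    using half[of N] by linarith
  have "(\<Sum>j\<in>{- int N..int N} - J n. ?f j) \<le> (\<Sum>j\<in>{- int N..- int n} \<union> {int n + 1..int N + 1}. ?f j)"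
    by (intro sum_mono2) (auto simp: J_def)
  also have "\<dots> = (\<Sum>j\<in>{- int N..- int n}. ?f j) + (\<Sum>j\<in>{int n + 1..int N + 1}. ?f j)"
    using assms(1) by (intro sum.union_disjoint) auto
  finally show ?thesis
    unfolding mult_2 using add_mono[OF left right] by (rule order_trans)
qed

text \<open>The left-hand side is the product of the \<open>\<ell>\<^sup>1\<close> and \<open>\<ell>\<^sup>2\<close> tail bounds, where \<open>m\<close> is
\<open>n D / 2\<close> rounded down and \<open>u = C / n\<^sup>m\<close>. Stirling's inequality gives
\<open>u\<^sup>2 \<le> e\<^sup>4 m exp (- D n) / (4 \<pi>\<^sup>2)\<close>, whose factor \<open>m\<close> combines with the \<open>\<ell>\<^sup>1\<close> factor
\<open>2 (1/n + 1/m)\<close> to at most \<open>2 + D\<close>; the \<open>\<ell>\<^sup>2\<close> factor supplies \<open>n\<^sup>-\<^sup>1\<^sup>/\<^sup>2\<close>. The remaining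
numerical inequality follows from \<open>e \<le> 3\<close> and \<open>\<pi> > 3\<close>.\<close>
lemma error_constant_le:
  fixes n m :: nat and D u A1 A2 :: real
  assumes D: "0 < D" and n: "n \<ge> 3" and m: "m \<ge> 1" and le: "2 * real m \<le> real n * D"
    and ge: "real n * D \<le> 2 * real m + 2" and ln: "1 \<le> ln (real n)"
    and C: "C = 2 ^ (m - 1) * fact m / (pi * D ^ m)"
  shows "2 * C * (1 / real n ^ Suc m + 1 / (real m * real n ^ m))
      * sqrt (2 * C\<^sup>2 * (1 / real n ^ Suc (2 * m + 1) + 1 / (real (2 * m + 1) * real n ^ (2 * m + 1))))
     \<le> 121 / 200 * exp (3 / 2) * (2 + D) * sqrt ((ln (real n) + 1) / (2 * real n)) * exp (- D * real n)"
proof -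
  have n0: "real n > 0" and m0: "real m > 0" using n m by auto
  define u where "u = C / real n ^ m"
  have C0: "C \<ge> 0" unfolding C using D by simp
  have u0: "u \<ge> 0" unfolding u_def using C0 by simp
  have u_le: "u \<le> exp 1 * sqrt (real m) * exp (- real m) / (2 * pi)"
  proof -
    have "u = fact m * (2 / (D * real n)) ^ m / (2 * pi)"
      using m D n0 by (cases m) (simp_all add: u_def C power_divide power_mult_distrib field_simps)
    also have "\<dots> \<le> exp 1 * sqrt (real m) * (real m / exp 1) ^ m * (2 / (D * real n)) ^ m / (2 * pi)"
      using D by (intro divide_right_mono mult_right_mono fact_le_stirling m) auto
    also have "\<dots> = exp 1 * sqrt (real m) * exp (- real m) * (2 * real m / (D * real n)) ^ m / (2 * pi)"
      by (simp add: power_divide power_mult_distrib exp_minus exp_of_nat_mult[of m 1, simplified] field_simps)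
    also have "\<dots> \<le> exp 1 * sqrt (real m) * exp (- real m) * 1 / (2 * pi)"
    proof (intro divide_right_mono mult_left_mono power_le_one)
      show "2 * real m / (D * real n) \<le> 1" using le D n0 by (simp add: mult.commute)
    qed (use D in auto)
    finally show ?thesis by simp
  qed
  have "u\<^sup>2 \<le> (exp 1 * sqrt (real m) * exp (- real m) / (2 * pi))\<^sup>2"
    using u_le u0 by (rule power_mono)
  also have "\<dots> = exp 2 * real m * exp (- 2 * real m) / (4 * pi\<^sup>2)"
    by (simp add: power_divide power_mult_distrib flip: exp_double)
  also have "\<dots> \<le> exp 2 * real m * exp (2 - D * real n) / (4 * pi\<^sup>2)"
    using ge by (intro divide_right_mono mult_left_mono) (auto simp: mult.commute)
  also have "\<dots> = exp 4 * exp (- D * real n) * real m / (4 * pi\<^sup>2)"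
    by (simp add: exp_diff exp_minus field_simps flip: exp_add)
  finally have u2: "u\<^sup>2 \<le> exp 4 * exp (- D * real n) * real m / (4 * pi\<^sup>2)" .
  have f1: "2 * C * (1 / real n ^ Suc m + 1 / (real m * real n ^ m)) = 2 * u * (1 / real n + 1 / real m)"
    using n0 m0 by (simp add: u_def field_simps)
  have "2 * C\<^sup>2 * (1 / real n ^ Suc (2 * m + 1) + 1 / (real (2 * m + 1) * real n ^ (2 * m + 1)))
      = u\<^sup>2 * (2 / real n * (1 / real n + 1 / real (2 * m + 1)))"
  proof -
    define q r Q where "q = real (2 * m + 1)" and "r = real n" and "Q = real n ^ (2 * m)"
    have pos: "q > 0" "r > 0" "Q > 0" using n0 by (auto simp: q_def r_def Q_def)
    have pw: "real n ^ Suc (2 * m + 1) = Q * r * r" "real n ^ (2 * m + 1) = Q * r"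
      by (simp_all add: Q_def r_def)
    have "Q = (real n ^ m)\<^sup>2" by (simp add: Q_def power_mult mult.commute)
    then have u2Q: "u\<^sup>2 = C\<^sup>2 / Q" by (simp add: u_def power_divide)
    show ?thesis
      unfolding pw u2Q unfolding q_def[symmetric] r_def[symmetric] using pos by (simp add: field_simps)
  qed
  also have "\<dots> \<le> u\<^sup>2 * (2 / real n * (1 / 3 + 1 / 3))"
  proof (intro mult_left_mono add_mono)
    show "1 / real n \<le> 1 / 3" using n by (intro divide_left_mono) auto
    show "1 / real (2 * m + 1) \<le> 1 / 3" using m by (intro divide_left_mono) auto
  qed auto
  also have "\<dots> = u\<^sup>2 * (4 / 3) / real n" by simp
  finally have "sqrt (2 * C\<^sup>2 * (1 / real n ^ Suc (2 * m + 1) + 1 / (real (2 * m + 1) * real n ^ (2 * m + 1))))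
      \<le> sqrt (u\<^sup>2 * (4 / 3) / real n)" by simp
  also have "\<dots> = u * sqrt (4 / 3) / sqrt (real n)"
    using u0 by (simp add: real_sqrt_mult real_sqrt_divide)
  finally have f2: "sqrt (2 * C\<^sup>2 * (1 / real n ^ Suc (2 * m + 1) + 1 / (real (2 * m + 1) * real n ^ (2 * m + 1))))
      \<le> u * sqrt (4 / 3) / sqrt (real n)" .
  have "2 * C * (1 / real n ^ Suc m + 1 / (real m * real n ^ m))
      * sqrt (2 * C\<^sup>2 * (1 / real n ^ Suc (2 * m + 1) + 1 / (real (2 * m + 1) * real n ^ (2 * m + 1))))
     \<le> 2 * u * (1 / real n + 1 / real m) * (u * sqrt (4 / 3) / sqrt (real n))"
    unfolding f1 using u0 by (intro mult_left_mono f2) auto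
  also have "\<dots> = u\<^sup>2 * (2 * (1 / real n + 1 / real m) * sqrt (4 / 3) / sqrt (real n))"
    by (simp add: power2_eq_square)
  also have "\<dots> \<le> exp 4 * exp (- D * real n) * real m / (4 * pi\<^sup>2) * (2 * (1 / real n + 1 / real m) * sqrt (4 / 3) / sqrt (real n))"
    by (intro mult_right_mono u2) auto
  also have "\<dots> = exp (- D * real n) / sqrt (real n) * (2 * real m / real n + 2) * (exp 4 * sqrt (4 / 3) / (4 * pi\<^sup>2))"
  proof -
    define X where "X = 2 * (1 / real n + 1 / real m)"
    have "real m * X = 2 * real m / real n + 2"
      using m0 by (simp add: X_def distrib_left)
    moreover have "exp 4 * exp (- D * real n) * real m / (4 * pi\<^sup>2) * (X * sqrt (4 / 3) / sqrt (real n))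
        = exp (- D * real n) / sqrt (real n) * (real m * X) * (exp 4 * sqrt (4 / 3) / (4 * pi\<^sup>2))"
      by (simp add: mult_ac)
    ultimately show ?thesis by (simp only: X_def)
  qed
  also have "\<dots> \<le> exp (- D * real n) / sqrt (real n) * (2 + D) * (121 / 200 * exp (3 / 2))"
  proof (intro mult_mono)
    show "2 * real m / real n + 2 \<le> 2 + D"
      using le n0 by (simp add: pos_divide_le_eq mult.commute)
    \<comment> \<open>Squaring removes the fractional exponent: \<open>e\<^sup>5 \<sqdot> 4/3 \<le> 324 = 18\<^sup>2\<close>.\<close>
    have "(exp (5 / 2) * sqrt (4 / 3))\<^sup>2 = exp 1 ^ 5 * (4 / 3 :: real)"
      by (simp add: power_mult_distrib flip: exp_double exp_of_nat_mult)
    also have "\<dots> \<le> 3 ^ 5 * (4 / 3)"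
      using exp_le by (intro mult_right_mono power_mono) auto
    also have "\<dots> = 18\<^sup>2" by simp
    finally have "exp (5 / 2) * sqrt (4 / 3) \<le> (18 :: real)" by (rule power2_le_imp_le) simp
    also have "18 \<le> 121 / 200 * (4 * (3::real)\<^sup>2)" by simp
    also have "\<dots> \<le> 121 / 200 * (4 * pi\<^sup>2)"
      using pi_gt3 by (intro mult_left_mono power_mono) auto
    finally have num: "exp (5 / 2) * sqrt (4 / 3) \<le> 121 / 200 * (4 * pi\<^sup>2)" .
    have "exp 4 = exp (3 / 2) * exp (5 / 2 :: real)" by (simp flip: exp_add)
    then have "exp 4 * sqrt (4 / 3) = exp (3 / 2) * (exp (5 / 2) * sqrt (4 / 3))" by simp
    also have "\<dots> \<le> exp (3 / 2) * (121 / 200 * (4 * pi\<^sup>2))"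
      by (intro mult_left_mono num) auto
    finally have "exp 4 * sqrt (4 / 3) \<le> 121 / 200 * exp (3 / 2) * (4 * pi\<^sup>2)" by (simp add: mult_ac)
    then show "exp 4 * sqrt (4 / 3) / (4 * pi\<^sup>2) \<le> 121 / 200 * exp (3 / 2)"
      by (subst pos_divide_le_eq) auto
  qed (use D in auto)
  also have "\<dots> = 121 / 200 * exp (3 / 2) * (2 + D) * (1 / sqrt (real n)) * exp (- D * real n)"
    by (simp add: mult_ac)
  also have "\<dots> \<le> 121 / 200 * exp (3 / 2) * (2 + D) * sqrt ((ln (real n) + 1) / (2 * real n)) * exp (- D * real n)"
  proof (intro mult_right_mono mult_left_mono)
    have "1 / real n \<le> (ln (real n) + 1) / (2 * real n)"
      using ln n0 by (simp add: field_simps)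
    then have "sqrt (1 / real n) \<le> sqrt ((ln (real n) + 1) / (2 * real n))" by simp
    then show "1 / sqrt (real n) \<le> sqrt ((ln (real n) + 1) / (2 * real n))"
      by (simp add: real_sqrt_divide)
  qed (use D in auto)
  finally show ?thesis .
qed

section \<open>The error bound\<close>

lemma abs_sinc_pi_le:
  assumes "x \<noteq> 0"
  shows "\<bar>sinc_pi x\<bar> \<le> 1 / (pi * \<bar>x\<bar>)"
  using assms by (auto simp: sinc_pi_def abs_mult intro!: divide_right_mono)

lemma reconstruction_coefficient_le:
  assumes k: "k \<ge> 1" and \<delta>: "\<delta> < pi" and x: "x \<noteq> 0"
  shows "cmod (complex_of_real (sinc_pi x) * spline_ft \<delta> k x)
      \<le> 2 ^ (k - 1) * fact k / (pi * (pi - \<delta>) ^ k) * (1 / \<bar>x\<bar> ^ Suc k)"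
proof -
  have "cmod (complex_of_real (sinc_pi x) * spline_ft \<delta> k x)
      \<le> 1 / (pi * \<bar>x\<bar>) * (2 ^ (k - 1) * fact k / ((pi - \<delta>) ^ k * \<bar>x\<bar> ^ k))"
    unfolding norm_mult norm_of_real
    by (intro mult_mono abs_sinc_pi_le norm_spline_ft_le assms) auto
  then show ?thesis by (simp add: mult_ac)
qed

theorem theorem3p4:
  fixes M :: "'w measure" and \<delta> :: real and n :: nat
  assumes "prob_space M"
    and "0 < \<delta>" and "\<delta> < pi"
    and "real n > max (2 / (pi - \<delta>)) (exp 1)"
  shows "error_A2 M \<delta> n \<le>
    ereal (sqrt (121 / 200) * exp (3 / 4) * sqrt (2 + pi - \<delta>) *
      ((ln (real n) + 1) / (2 * real n)) powr (1 / 4) *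
      exp (- ((pi - \<delta>) / 2) * real n))"
  unfolding error_A2_def
proof (rule Sup_least)
  let ?T = "sqrt (121 / 200) * exp (3 / 4) * sqrt (2 + pi - \<delta>) *
      ((ln (real n) + 1) / (2 * real n)) powr (1 / 4) * exp (- ((pi - \<delta>) / 2) * real n)"
  fix y assume "y \<in> {ereal (L2_norm M (\<lambda>\<omega>. X t \<omega> - A2 \<delta> n X t \<omega>)) | t X.
            t \<in> {0<..<1} \<and> wss M X \<and> autocorr M X \<in> paley_wiener_unit_ball \<delta>}"
  then obtain t X where y: "y = ereal (L2_norm M (\<lambda>\<omega>. X t \<omega> - A2 \<delta> n X t \<omega>))"
    and t: "0 < t" "t < 1" and X: "wss M X" and R: "autocorr M X \<in> paley_wiener_unit_ball \<delta>"
    by auto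
  obtain g where Rc: "continuous_on UNIV (autocorr M X)" and Rn: "L2_norm lborel (autocorr M X) \<le> 1"
    and Rg: "has_L2_fourier_transform (autocorr M X) g"
    and supp: "AE \<xi> in lborel. \<xi> \<notin> {-\<delta>..\<delta>} \<longrightarrow> g \<xi> = 0"
    using R by (auto simp: paley_wiener_unit_ball_def paley_wiener_def)
  note bdd = wss_autocorr_bounded[OF X]
  have g_sq: "square_integrable lborel g" using Rg by (simp add: has_L2_fourier_transform_def)
  have g_int: "integrable lborel g" by (rule square_integrable_bounded_support_integrable[OF g_sq supp])
  have g_norm: "L2_norm lborel g \<le> 1"
    using Rn unfolding L2_fourier_plancherel[OF Rc bdd Rg g_int] .
  define D where "D = pi - \<delta>"
  define m where "m = nat \<lfloor>real n * (pi - \<delta>) / 2\<rfloor>"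
  have D: "0 < D" using assms by (simp add: D_def)
  have nD: "real n * D > 2"
    using assms(4) D by (simp add: D_def pos_divide_less_eq)
  have n_e: "exp 1 < real n" using assms(4) by simp
  have "2 < real n" using n_e exp_ge_add_one_self[of 1] by linarith
  then have n3: "n \<ge> 3" by simp
  have ln_n: "1 \<le> ln (real n)" using n_e n3 by (subst ln_ge_iff) auto
  have m_floor: "real m = of_int \<lfloor>real n * D / 2\<rfloor>"
    using nD by (simp add: m_def D_def)
  have m_le: "2 * real m \<le> real n * D" and m_ge: "real n * D \<le> 2 * real m + 2"
    unfolding m_floor by linarith+
  have m1: "m \<ge> 1" using m_ge nD by (cases m) auto
  define c where "c j = complex_of_real (sinc_pi (t - of_int j)) * spline_ft \<delta> m (t - of_int j)" for j :: int
  define C where "C = 2 ^ (m - 1) * fact m / (pi * D ^ m)"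
  have C0: "C \<ge> 0" using D by (simp add: C_def)
  define S1 where "S1 = 2 * C * (1 / real n ^ Suc m + 1 / (real m * real n ^ m))"
  define S2 where "S2 = 2 * C\<^sup>2 * (1 / real n ^ Suc (2 * m + 1) + 1 / (real (2 * m + 1) * real n ^ (2 * m + 1)))"
  have nz: "t - of_int j \<noteq> 0" for j
    using t by (metis eq_iff_diff_eq_0 of_int_0_less_iff of_int_less_1_iff zless_imp_add1_zle add_0 not_le)
  have c_le: "cmod (c j) \<le> C * (1 / \<bar>t - of_int j\<bar> ^ Suc m)" for j
    unfolding c_def C_def D_def by (rule reconstruction_coefficient_le[OF m1 assms(3) nz])
  have l1: "(\<Sum>j\<in>{- int N..int N} - J n. cmod (c j)) \<le> S1" for N
  proof -
    have "(\<Sum>j\<in>{- int N..int N} - J n. cmod (c j)) \<le> C * (\<Sum>j\<in>{- int N..int N} - J n. 1 / \<bar>t - of_int j\<bar> ^ Suc m)"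
      unfolding sum_distrib_left by (intro sum_mono c_le)
    also have "\<dots> \<le> C * (2 * (1 / real n ^ Suc m + 1 / (real m * real n ^ m)))"
      using n3 m1 t C0 by (intro mult_left_mono sum_distance_power_tail_le) auto
    finally show ?thesis by (simp only: S1_def mult.assoc mult.left_commute)
  qed
  have l2: "(\<Sum>j\<in>{- int N..int N} - J n. (cmod (c j))\<^sup>2) \<le> S2" for N
  proof -
    have "(cmod (c j))\<^sup>2 \<le> C\<^sup>2 * (1 / \<bar>t - of_int j\<bar> ^ Suc (2 * m + 1))" for j
    proof -
      have "(cmod (c j))\<^sup>2 \<le> (C * (1 / \<bar>t - of_int j\<bar> ^ Suc m))\<^sup>2" by (intro power_mono c_le) auto
      also have "\<dots> = C\<^sup>2 * (1 / (\<bar>t - of_int j\<bar> ^ Suc m)\<^sup>2)" by (simp only: power_mult_distrib power_divide power_one)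
      also have "(\<bar>t - of_int j\<bar> ^ Suc m)\<^sup>2 = \<bar>t - of_int j\<bar> ^ Suc (2 * m + 1)"
        unfolding power_mult[symmetric] by (simp add: mult.commute)
      finally show ?thesis .
    qed
    then have "(\<Sum>j\<in>{- int N..int N} - J n. (cmod (c j))\<^sup>2) \<le> C\<^sup>2 * (\<Sum>j\<in>{- int N..int N} - J n. 1 / \<bar>t - of_int j\<bar> ^ Suc (2 * m + 1))"
      unfolding sum_distrib_left by (intro sum_mono)
    also have "\<dots> \<le> C\<^sup>2 * (2 * (1 / real n ^ Suc (2 * m + 1) + 1 / (real (2 * m + 1) * real n ^ (2 * m + 1))))"
      using n3 m1 t by (intro mult_left_mono sum_distance_power_tail_le) auto
    finally show ?thesis by (simp only: S2_def mult.assoc mult.left_commute)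
  qed
  \<comment> \<open>The error as a single linear combination: \<open>None\<close> indexes the time \<open>t\<close>, and \<open>Some j\<close> the
    sampling time \<open>j\<close>.\<close>
  define I where "I = insert None (Some ` J n)"
  define b where "b i = (case i of None \<Rightarrow> 1 | Some j \<Rightarrow> - c j)" for i
  define s where "s i = (case i of None \<Rightarrow> t | Some j \<Rightarrow> real_of_int j)" for i
  have I_sum: "(\<Sum>i\<in>I. b i * z (s i)) = z t - (\<Sum>j\<in>J n. c j * z (of_int j))" for z :: "real \<Rightarrow> complex"
    by (simp add: I_def J_def b_def s_def sum.reindex inj_on_def sum_negf)
  have err: "X t \<omega> - A2 \<delta> n X t \<omega> = (\<Sum>i\<in>I. b i * X (s i) \<omega>)" for \<omega>
    using I_sum[of "\<lambda>u. X u \<omega>"] by (simp add: A2_def Let_def c_def m_def mult_ac)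
  have "sqrt (2 * pi) * (LINT \<omega>|M. (cmod (X t \<omega> - A2 \<delta> n X t \<omega>))\<^sup>2)
      = cmod (sqrt (2 * pi) * complex_of_real (LINT \<omega>|M. (cmod (\<Sum>i\<in>I. b i * X (s i) \<omega>))\<^sup>2))"
    by (simp add: norm_mult err)
  also have "\<dots> = cmod (LINT \<xi>|lborel. g \<xi> * of_real ((cmod (\<Sum>i\<in>I. b i * exp (\<i> * of_real (s i * \<xi>))))\<^sup>2))"
    by (simp only: wss_spectral_isometry[OF X g_int L2_fourier_inversion[OF Rc bdd Rg g_int]])
  also have "\<dots> = cmod (LINT \<xi>|lborel. g \<xi> * of_real ((cmod (exp (\<i> * of_real (\<xi> * t)) - (\<Sum>j\<in>J n. c j * exp (\<i> * of_real \<xi> * of_int j))))\<^sup>2))"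
  proof -
    have "(\<Sum>i\<in>I. b i * exp (\<i> * of_real (s i * \<xi>)))
        = exp (\<i> * of_real (\<xi> * t)) - (\<Sum>j\<in>J n. c j * exp (\<i> * of_real \<xi> * of_int j))" for \<xi>
      using I_sum[of "\<lambda>u. exp (\<i> * of_real (u * \<xi>))"] by (simp add: mult_ac)
    then show ?thesis by (simp only:)
  qed
  also have "\<dots> \<le> sqrt (2 * pi) * (S1 * sqrt S2)"
  proof (rule weighted_tail_bound[OF g_sq g_norm supp])
    show "(\<lambda>N. \<Sum>j\<in>{- int N..int N}. c j * exp (\<i> * of_real \<xi> * of_int j)) \<longlonglongrightarrow> exp (\<i> * of_real (\<xi> * t))"
      if "\<bar>\<xi>\<bar> \<le> \<delta>" for \<xi>
      unfolding c_def by (rule spline_sampling_exponential[OF m1 assms(3) that t])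
    show "J n \<subseteq> {- int n..int n}" by (auto simp: J_def)
    show "(\<lambda>\<xi>. exp (\<i> * complex_of_real (\<xi> * t))) \<in> borel_measurable borel"
      by (intro borel_measurable_continuous_onI continuous_intros)
  qed (use assms l1 l2 in auto)
  finally have "(LINT \<omega>|M. (cmod (X t \<omega> - A2 \<delta> n X t \<omega>))\<^sup>2) \<le> S1 * sqrt S2" by simp
  also have "\<dots> \<le> 121 / 200 * exp (3 / 2) * (2 + D) * sqrt ((ln (real n) + 1) / (2 * real n)) * exp (- D * real n)"
    unfolding S1_def S2_def by (rule error_constant_le[OF D n3 m1 m_le m_ge ln_n C_def])
  also have "\<dots> = ?T\<^sup>2"
  proof -
    have "0 \<le> (ln (real n) + 1) / (2 * real n)" using ln_n by simp
    then have "(((ln (real n) + 1) / (2 * real n)) powr (1 / 4))\<^sup>2 = sqrt ((ln (real n) + 1) / (2 * real n))"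
      by (simp add: power2_eq_square powr_half_sqrt flip: powr_add)
    moreover have "(exp (3 / 4 :: real))\<^sup>2 = exp (3 / 2)" by (simp flip: exp_double)
    moreover have "(exp (- ((pi - \<delta>) / 2) * real n))\<^sup>2 = exp (- D * real n)" by (simp add: D_def field_simps flip: exp_double)
    moreover have "(sqrt (2 + pi - \<delta>))\<^sup>2 = 2 + D" using assms by (simp add: D_def)
    ultimately show ?thesis by (simp add: power_mult_distrib)
  qed
  finally have "L2_norm M (\<lambda>\<omega>. X t \<omega> - A2 \<delta> n X t \<omega>) \<le> ?T"
    unfolding L2_norm_def using assms by (intro real_le_lsqrt) auto
  then show "y \<le> ereal ?T" by (simp add: y)
qed

end
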